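(* Let $G$ be a profinite group. Then $G$ is covered by countably many procyclic subgroups (that is, $G$ is equal to the union of countably many procyclic subgroups) if and only if $G$ is finite-by-procyclic.
   Context: A profinite group is procyclic if it is topologically generated by one element; procyclic subgroups are closed subgroups. A profinite group $G$ is finite-by-procyclic if it has a finite normal subgroup $N$ such that $G/N$ is procyclic. "Countably many" means finitely or countably infinitely many. *)

theory Defs
  imports "HOL-Analysis.Analysis" "HOL-Algebra.Generated_Groups"
begin

definition totally_disconnected_space :: "'a topology \<Rightarrow> bool" where
  "totally_disconnected_space T \<longleftrightarrow> (\<forall>S. connectedin T S \<longrightarrow> (\<exists>a. S \<subseteq> {a}))"

text \<open>The finest topology on \<open>f ` topspace T\<close> for which \<open>f\<close> is continuous.\<close>

definition quotient_topology :: "'a topology \<Rightarrow> ('a \<Rightarrow> 'b) \<Rightarrow> 'b topology" where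
  "quotient_topology T f =
     topology (\<lambda>V. V \<subseteq> f ` topspace T \<and> openin T {x \<in> topspace T. f x \<in> V})"

lemma openin_quotient_topology:
  "openin (quotient_topology T f) V \<longleftrightarrow>
     V \<subseteq> f ` topspace T \<and> openin T {x \<in> topspace T. f x \<in> V}"
proof -
  have "istopology (\<lambda>V. V \<subseteq> f ` topspace T \<and> openin T {x \<in> topspace T. f x \<in> V})"
    unfolding istopology_def
  proof (intro conjI allI impI)
    fix A B
    assume A: "A \<subseteq> f ` topspace T \<and> openin T {x \<in> topspace T. f x \<in> A}"
      and B: "B \<subseteq> f ` topspace T \<and> openin T {x \<in> topspace T. f x \<in> B}"
    then show "A \<inter> B \<subseteq> f ` topspace T" by blast
    have "{x \<in> topspace T. f x \<in> A \<inter> B} =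
        {x \<in> topspace T. f x \<in> A} \<inter> {x \<in> topspace T. f x \<in> B}" by blast
    moreover have "openin T ({x \<in> topspace T. f x \<in> A} \<inter> {x \<in> topspace T. f x \<in> B})"
      using A B by (intro openin_Int) blast+
    ultimately show "openin T {x \<in> topspace T. f x \<in> A \<inter> B}"
      by (rule ssubst)
  next
    fix K
    assume K: "\<forall>V\<in>K. V \<subseteq> f ` topspace T \<and> openin T {x \<in> topspace T. f x \<in> V}"
    then show "\<Union>K \<subseteq> f ` topspace T" by blast
    have "{x \<in> topspace T. f x \<in> \<Union>K} = (\<Union>V\<in>K. {x \<in> topspace T. f x \<in> V})"
      by blast
    moreover have "openin T (\<Union>V\<in>K. {x \<in> topspace T. f x \<in> V})"
      using K by (intro openin_Union) blast
    ultimately show "openin T {x \<in> topspace T. f x \<in> \<Union>K}"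
      by (rule ssubst)
  qed
  then show ?thesis
    by (simp add: quotient_topology_def)
qed

lemma topspace_quotient_topology: "topspace (quotient_topology T f) = f ` topspace T"
proof
  show "topspace (quotient_topology T f) \<subseteq> f ` topspace T"
    using openin_topspace[of "quotient_topology T f"]
    unfolding openin_quotient_topology by (rule conjunct1)
  have "{x \<in> topspace T. f x \<in> f ` topspace T} = topspace T" by blast
  then have "openin (quotient_topology T f) (f ` topspace T)"
    unfolding openin_quotient_topology by simp
  then show "f ` topspace T \<subseteq> topspace (quotient_topology T f)"
    by (rule openin_subset)
qed

lemma quotient_map_quotient_topology: "quotient_map T (quotient_topology T f) f"
  unfolding quotient_map_def topspace_quotient_topology openin_quotient_topology by blast

locale topological_group = group G for G (structure) +
  fixes T
  assumes topspace_eq: "topspace T = carrier G"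
    and continuous_mult: "continuous_map (prod_topology T T) T (\<lambda>(x, y). x \<otimes> y)"
    and continuous_inv: "continuous_map T T (\<lambda>x. inv x)"

text \<open>Profinite groups are taken in the intrinsic form (compact, Hausdorff, totally disconnected),
  since the inverse limit of a system of finite groups would fix a carrier type for the system.\<close>

locale profinite_group = topological_group +
  assumes compact: "compact_space T"
    and Hausdorff: "Hausdorff_space T"
    and totally_disconnected: "totally_disconnected_space T"

definition procyclic :: "('a, 'b) monoid_scheme \<Rightarrow> 'a topology \<Rightarrow> bool" where
  "procyclic G T \<longleftrightarrow> profinite_group G T \<and>
     (\<exists>g \<in> carrier G. Abstract_Topology.closure_of T (generate G {g}) = carrier G)"

text \<open>\<open>closure_of\<close> is written in prefix form above because its infix syntax is ambiguous with
  the notation for \<open>eq_closure_of\<close> in HOL-Algebra.\<close>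

definition procyclic_subgroup :: "'a set \<Rightarrow> ('a, 'b) monoid_scheme \<Rightarrow> 'a topology \<Rightarrow> bool" where
  "procyclic_subgroup H G T \<longleftrightarrow> subgroup H G \<and> closedin T H \<and>
     procyclic (G\<lparr>carrier := H\<rparr>) (subtopology T H)"

definition finite_by_procyclic :: "('a, 'b) monoid_scheme \<Rightarrow> 'a topology \<Rightarrow> bool" where
  "finite_by_procyclic G T \<longleftrightarrow> profinite_group G T \<and>
     (\<exists>N. N \<lhd> G \<and> finite N \<and>
        procyclic (G Mod N) (quotient_topology T (\<lambda>x. N #>\<^bsub>G\<^esub> x)))"

end

theory Submission
  imports Defs "HOL-Algebra.Multiplicative_Group"
begin

text \<open>
  Both conditions are equivalent to a third one, which the locale \<open>central_procyclic\<close> records: \<open>G\<close>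
  has an open central procyclic subgroup \<open>Z\<close>. Such a \<open>Z\<close> has some finite index \<open>m\<close>.

  \<^item> From a countable procyclic cover to \<open>Z\<close>. By Baire, every non-empty open set meets a member of the
    cover that is itself open. Fix an open member \<open>H\<close>. For each of the finitely many cosets of \<open>H\<close>
    some open member \<open>C\<close> meets that coset, and since \<open>C\<close> and \<open>H\<close> are abelian, the open subgroup
    \<open>C \<inter> H\<close> centralises the coset. The intersection of these finitely many subgroups is open and
    central, and it is procyclic as a closed subgroup of \<open>H\<close>.

  \<^item> From a finite normal \<open>N\<close> with procyclic quotient to \<open>Z\<close>. Lift a generator of the quotient to \<open>g\<close>
    and let \<open>C\<close> be the closure of the group generated by \<open>g\<close>. Then \<open>G\<close> is the product of \<open>C\<close> and \<open>N\<close>, so \<open>C\<close> is open,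
    and the elements of \<open>C\<close> that centralise \<open>N\<close> form an open central subgroup.

  \<^item> From \<open>Z\<close> to finite-by-procyclic. The transfer is a continuous homomorphism from \<open>G\<close> to \<open>Z\<close>
    that restricts to \<open>t \<mapsto> t\<^sup>m\<close> on \<open>Z\<close>. A procyclic group has only finitely many \<open>m\<close>-torsion elements,
    so the kernel is finite, and \<open>G\<close> modulo the kernel is isomorphic to a closed subgroup of \<open>Z\<close>.

  \<^item> From \<open>Z\<close> to a countable cover (\<open>countable_procyclic_cover\<close>). Let \<open>P\<close> be the intersection of the
    subgroups of \<open>m^k\<close>-th powers in \<open>Z\<close>, the part of \<open>Z\<close> of order prime to \<open>m\<close>. The cover
    consists of all procyclic subgroups of \<open>G\<close> that contain \<open>P\<close>. They cover \<open>G\<close>: as \<open>P\<close> is \<open>m\<close>-divisible,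
    any \<open>x\<close> can be multiplied by some \<open>t \<in> P\<close> so that \<open>x t\<close> topologically generates a group containing
    \<open>P\<close>, hence containing \<open>x\<close>. There are only countably many of them: a closed subgroup \<open>D\<close> of \<open>Z\<close>
    that contains \<open>P\<close> is an intersection of the subgroups of \<open>a r^j\<close>-th powers for two natural numbers
    \<open>a\<close> and \<open>r\<close>, and a procyclic subgroup meeting \<open>Z\<close> in \<open>D\<close> is determined by \<open>D\<close> and by the coset of \<open>D\<close>
    containing a generator, for which there are finitely many possibilities.

  Everything about procyclic groups is derived from the fact that their open subgroups are the
  groups of \<open>d\<close>-th powers with \<open>d > 0\<close>, which form a basis of neighbourhoods of the identity.
\<close>

section \<open>Subgroups\<close>

lemma (in group) nat_pow_closed_subgroup:
  "subgroup H G \<Longrightarrow> h \<in> H \<Longrightarrow> h [^] (n::nat) \<in> H"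
  using subgroup_int_pow_closed[of H h "int n"] by (simp add: int_pow_int)

lemma (in group) subgroup_centralizer_elem:
  assumes "a \<in> carrier G"
  shows "subgroup {x \<in> carrier G. x \<otimes> a = a \<otimes> x} G"
proof
  show "x \<otimes> y \<in> {x \<in> carrier G. x \<otimes> a = a \<otimes> x}"
    if "x \<in> {x \<in> carrier G. x \<otimes> a = a \<otimes> x}" "y \<in> {x \<in> carrier G. x \<otimes> a = a \<otimes> x}" for x y
  proof -
    have "x \<otimes> y \<otimes> a = x \<otimes> (a \<otimes> y)" using that assms by (simp add: m_assoc)
    also have "\<dots> = a \<otimes> (x \<otimes> y)" using that assms by (simp add: m_assoc[symmetric])
    finally show ?thesis using that by simp
  qed
  show "inv x \<in> {x \<in> carrier G. x \<otimes> a = a \<otimes> x}" if "x \<in> {x \<in> carrier G. x \<otimes> a = a \<otimes> x}" for x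
  proof -
    have x: "x \<in> carrier G" and eq: "x \<otimes> a = a \<otimes> x" using that by auto
    have "inv x \<otimes> a = inv x \<otimes> (a \<otimes> x) \<otimes> inv x" using x assms by (simp add: m_assoc)
    also have "\<dots> = inv x \<otimes> (x \<otimes> a) \<otimes> inv x" by (simp add: eq)
    also have "\<dots> = a \<otimes> inv x" using x assms by (simp add: m_assoc[symmetric])
    finally have "inv x \<otimes> a = a \<otimes> inv x" .
    then show ?thesis using that by simp
  qed
qed (use assms in auto)

text \<open>
  Together with \<open>D\<close>, any two elements of one coset of \<open>D\<close> generate the same group. This is what bounds
  the number of procyclic subgroups with a prescribed intersection with \<open>Z\<close>.
\<close>

lemma (in group) generate_insert_r_coset:
  assumes D: "subgroup D G" and f: "f \<in> carrier G" and y: "y \<in> D #> f"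
  shows "generate G (insert y D) = generate G (insert f D)"
proof -
  have DG: "D \<subseteq> carrier G" using D by (rule subgroup.subset)
  obtain q where q: "q \<in> D" "y = q \<otimes> f" using y by (auto simp: r_coset_def)
  have yG: "y \<in> carrier G" using q f DG by auto
  have fq: "f = inv q \<otimes> y" using q f DG by (simp add: m_assoc[symmetric] subset_iff)
  have "y \<in> generate G (insert f D)"
    unfolding q(2) using q(1) by (intro generate.eng generate.incl) auto
  moreover have "f \<in> generate G (insert y D)"
    by (subst fq, intro generate.eng generate.inv generate.incl) (use q(1) in auto)
  ultimately show ?thesis
    using f yG DG by (intro equalityI generate_subgroup_incl generate_is_subgroup) (auto intro: generate.incl)
qed

section \<open>Topological groups\<close>

definition topgen :: "('a, 'b) monoid_scheme \<Rightarrow> 'a topology \<Rightarrow> 'a \<Rightarrow> 'a set" where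
  "topgen G T g = Abstract_Topology.closure_of T (generate G {g})"

context topological_group
begin

lemma continuous_map_mult:
  assumes "continuous_map X T f" "continuous_map X T g"
  shows "continuous_map X T (\<lambda>x. f x \<otimes> g x)"
proof -
  have "continuous_map X T ((\<lambda>(x, y). x \<otimes> y) \<circ> (\<lambda>x. (f x, g x)))"
    by (rule continuous_map_compose[OF _ continuous_mult]) (simp add: continuous_map_pairedI assms)
  then show ?thesis by (simp add: o_def)
qed

lemma continuous_map_inv:
  assumes "continuous_map X T f"
  shows "continuous_map X T (\<lambda>x. inv (f x))"
  using continuous_map_compose[OF assms continuous_inv] by (simp add: o_def)

lemma continuous_map_pow: "continuous_map T T (\<lambda>x. x [^] (n::nat))"
  by (induction n) (auto simp: topspace_eq intro: continuous_map_mult continuous_map_id[unfolded id_def])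

lemma continuous_map_rmult: "g \<in> carrier G \<Longrightarrow> continuous_map T T (\<lambda>x. x \<otimes> g)"
  by (intro continuous_map_mult) (auto simp: topspace_eq)

lemma r_coset_eq_preimage:
  assumes "U \<subseteq> carrier G" "g \<in> carrier G"
  shows "U #> g = {x \<in> topspace T. x \<otimes> inv g \<in> U}"
proof
  show "U #> g \<subseteq> {x \<in> topspace T. x \<otimes> inv g \<in> U}"
    using assms by (auto simp: r_coset_def topspace_eq m_assoc)
  show "{x \<in> topspace T. x \<otimes> inv g \<in> U} \<subseteq> U #> g"
  proof
    fix x assume x: "x \<in> {x \<in> topspace T. x \<otimes> inv g \<in> U}"
    then have "x = (x \<otimes> inv g) \<otimes> g" using assms by (simp add: topspace_eq m_assoc)
    with x show "x \<in> U #> g" unfolding r_coset_def by blast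
  qed
qed

lemma openin_r_coset:
  assumes "openin T U" "g \<in> carrier G"
  shows "openin T (U #> g)"
  using openin_continuous_map_preimage[OF continuous_map_rmult[of "inv g"] assms(1)]
    r_coset_eq_preimage[of U g] openin_subset[OF assms(1)] assms(2) by (simp add: topspace_eq)

lemma closedin_r_coset:
  assumes "closedin T U" "g \<in> carrier G"
  shows "closedin T (U #> g)"
  using closedin_continuous_map_preimage[OF continuous_map_rmult[of "inv g"] assms(1)]
    r_coset_eq_preimage[of U g] closedin_subset[OF assms(1)] assms(2) by (simp add: topspace_eq)

lemma r_coset_disjoint:
  assumes "subgroup H G" "x \<in> carrier G" "x \<notin> H"
  shows "(H #> x) \<inter> H = {}"
proof -
  have False if h: "h \<in> H" "h \<otimes> x \<in> H" for h
  proof -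
    have "inv h \<otimes> (h \<otimes> x) \<in> H" using that assms(1) by (meson subgroup.m_closed subgroup.m_inv_closed)
    moreover have "inv h \<otimes> (h \<otimes> x) = x"
      using h(1) assms subgroup.mem_carrier[OF assms(1)] by (simp add: m_assoc[symmetric])
    ultimately show False using assms(3) by simp
  qed
  then show ?thesis by (auto simp: r_coset_def)
qed

text \<open>
  The translates of \<open>U\<close> by elements of \<open>H\<close> cover \<open>H\<close>.
\<close>

lemma openin_subgroupI:
  assumes "subgroup H G" "openin T U" "U \<noteq> {}" "U \<subseteq> H"
  shows "openin T H"
proof -
  obtain u where u: "u \<in> U" using assms(3) by blast
  have H: "H \<subseteq> carrier G" using assms(1) by (rule subgroup.subset)
  have uH: "u \<in> H" using u assms(4) by blast
  have "H = (\<Union>h\<in>H. U #> (inv u \<otimes> h))"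
  proof
    show "H \<subseteq> (\<Union>h\<in>H. U #> (inv u \<otimes> h))"
    proof
      fix h assume h: "h \<in> H"
      then have "h = u \<otimes> (inv u \<otimes> h)" using uH H by (simp add: m_assoc[symmetric] subsetD)
      with h u show "h \<in> (\<Union>h\<in>H. U #> (inv u \<otimes> h))" by (auto simp: r_coset_def)
    qed
    show "(\<Union>h\<in>H. U #> (inv u \<otimes> h)) \<subseteq> H"
    proof
      fix x assume "x \<in> (\<Union>h\<in>H. U #> (inv u \<otimes> h))"
      then obtain h v where "h \<in> H" "v \<in> U" "x = v \<otimes> (inv u \<otimes> h)" by (auto simp: r_coset_def)
      then show "x \<in> H" using assms uH by (metis subgroup.m_closed subgroup.m_inv_closed subsetD)
    qed
  qed
  moreover have "openin T (\<Union>h\<in>H. U #> (inv u \<otimes> h))"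
    using uH H by (intro openin_Union) (auto intro!: openin_r_coset assms(2))
  ultimately show ?thesis by simp
qed

lemma open_subgroup_closedin:
  assumes "subgroup H G" "openin T H"
  shows "closedin T H"
proof -
  have "x \<in> topspace T - H" if "x \<in> H #> y" "y \<in> carrier G - H" for x y
    using that r_coset_disjoint[OF assms(1), of y] r_coset_subset_G[OF subgroup.subset[OF assms(1)], of y]
    by (auto simp: topspace_eq)
  then have "topspace T - H = (\<Union>x\<in>carrier G - H. H #> x)"
    using rcos_self[OF _ assms(1)] by (auto simp: topspace_eq)
  moreover have "openin T (\<Union>x\<in>carrier G - H. H #> x)"
    by (intro openin_Union) (auto intro!: openin_r_coset assms(2))
  ultimately show ?thesis
    using subgroup.subset[OF assms(1)] by (simp add: closedin_def topspace_eq)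
qed

text \<open>
  The complement of \<open>H\<close> is a finite union of cosets of \<open>H\<close>, hence closed.
\<close>

lemma closed_finite_index_openin:
  assumes "subgroup H G" "closedin T H" "finite F" "F \<subseteq> carrier G"
    and cover: "carrier G \<subseteq> (\<Union>f\<in>F. H #> f)"
  shows "openin T H"
proof -
  have H: "H \<subseteq> carrier G" using assms(1) by (rule subgroup.subset)
  have "topspace T - H = (\<Union>f\<in>F - H. H #> f)"
  proof
    show "topspace T - H \<subseteq> (\<Union>f\<in>F - H. H #> f)"
    proof
      fix x assume x: "x \<in> topspace T - H"
      then obtain f where f: "f \<in> F" "x \<in> H #> f" using cover by (auto simp: topspace_eq)
      have "f \<notin> H"
      proof
        assume "f \<in> H"
        then have "H #> f \<subseteq> H" using assms(1) by (auto simp: r_coset_def subgroup.m_closed)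
        then show False using f x by blast
      qed
      then show "x \<in> (\<Union>f\<in>F - H. H #> f)" using f by blast
    qed
    show "(\<Union>f\<in>F - H. H #> f) \<subseteq> topspace T - H"
    proof
      fix x assume "x \<in> (\<Union>f\<in>F - H. H #> f)"
      then obtain f where "f \<in> F - H" "x \<in> H #> f" by blast
      then show "x \<in> topspace T - H"
        using r_coset_disjoint[OF assms(1), of f] r_coset_subset_G[OF H, of f] assms(4)
        by (auto simp: topspace_eq)
    qed
  qed
  moreover have "closedin T (\<Union>f\<in>F - H. H #> f)"
    using assms by (intro closedin_Union) (auto intro!: closedin_r_coset)
  ultimately show ?thesis using H by (simp add: openin_closedin_eq topspace_eq)
qed

lemma closure_of_subgroup:
  assumes "subgroup H G"
  shows "subgroup (Abstract_Topology.closure_of T H) G"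
proof -
  let ?C = "Abstract_Topology.closure_of T H"
  have H: "H \<subseteq> carrier G" using assms by (rule subgroup.subset)
  have HC: "H \<subseteq> ?C" using H by (simp add: closure_of_subset topspace_eq)
  have C: "?C \<subseteq> carrier G" using closure_of_subset_topspace[of T H] by (simp add: topspace_eq)
  show ?thesis
  proof
    show "?C \<subseteq> carrier G" by (rule C)
    show "\<one> \<in> ?C" using HC subgroup.one_closed[OF assms] by blast
    have "(\<lambda>(x, y). x \<otimes> y) ` (?C \<times> ?C) \<subseteq> Abstract_Topology.closure_of T ((\<lambda>(x, y). x \<otimes> y) ` (H \<times> H))"
      using continuous_map_image_closure_subset[OF continuous_mult, of "H \<times> H"]
      by (simp add: closure_of_Times)
    also have "\<dots> \<subseteq> ?C"
      using assms by (intro closure_of_mono) (auto simp: subgroup.m_closed)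
    finally show "x \<otimes> y \<in> ?C" if "x \<in> ?C" "y \<in> ?C" for x y using that by auto
    have "(\<lambda>x. inv x) ` ?C \<subseteq> Abstract_Topology.closure_of T ((\<lambda>x. inv x) ` H)"
      using continuous_map_image_closure_subset[OF continuous_inv, of H] .
    also have "\<dots> \<subseteq> ?C"
      using assms by (intro closure_of_mono) (auto simp: subgroup.m_inv_closed)
    finally show "inv x \<in> ?C" if "x \<in> ?C" for x using that by blast
  qed
qed

lemma closedin_topgen: "closedin T (topgen G T g)"
  unfolding topgen_def by simp

lemma subgroup_topgen: "g \<in> carrier G \<Longrightarrow> subgroup (topgen G T g) G"
  unfolding topgen_def by (intro closure_of_subgroup generate_is_subgroup) simp

lemma topgen_self: "g \<in> carrier G \<Longrightarrow> g \<in> topgen G T g"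
  unfolding topgen_def
  using closure_of_subset[of "generate G {g}" T] generate_incl[of "{g}"] generate.incl[of g "{g}" G]
  by (auto simp: topspace_eq)

lemma topgen_subset:
  assumes "subgroup H G" "closedin T H" "g \<in> H"
  shows "topgen G T g \<subseteq> H"
  unfolding topgen_def
  using assms by (intro closure_of_minimal generate_subgroup_incl) auto

text \<open>
  Such a set and its complement are both unions of cosets of the open subgroup \<open>U\<close>.
\<close>

lemma closedin_if_stable:
  assumes "subgroup U G" "openin T U" "A \<subseteq> carrier G"
    and stable: "\<And>u x. u \<in> U \<Longrightarrow> x \<in> A \<Longrightarrow> u \<otimes> x \<in> A"
  shows "closedin T A"
proof -
  have UG: "U \<subseteq> carrier G" using assms(1) by (rule subgroup.subset)
  have "y \<in> topspace T - A" if x: "x \<in> carrier G - A" and y: "y \<in> U #> x" for x y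
  proof -
    obtain u where u: "u \<in> U" "y = u \<otimes> x" using y by (auto simp: r_coset_def)
    have "x \<in> A" if "y \<in> A"
    proof -
      have "inv u \<otimes> y \<in> A" using that u(1) assms(1) by (auto intro: stable subgroup.m_inv_closed)
      moreover have "inv u \<otimes> y = x" using u x UG by (auto simp: m_assoc[symmetric])
      ultimately show ?thesis by simp
    qed
    then show ?thesis using u x UG by (auto simp: topspace_eq)
  qed
  then have "(\<Union>x\<in>carrier G - A. U #> x) \<subseteq> topspace T - A" by blast
  moreover have "topspace T - A \<subseteq> (\<Union>x\<in>carrier G - A. U #> x)"
  proof
    fix x assume "x \<in> topspace T - A"
    then have "x \<in> carrier G - A" by (simp add: topspace_eq)
    then show "x \<in> (\<Union>x\<in>carrier G - A. U #> x)" using rcos_self[OF _ assms(1)] by blast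
  qed
  ultimately have "topspace T - A = (\<Union>x\<in>carrier G - A. U #> x)" by blast
  moreover have "openin T (\<Union>x\<in>carrier G - A. U #> x)"
    by (intro openin_Union) (auto intro!: openin_r_coset assms(2))
  ultimately show ?thesis using assms(3) by (simp add: closedin_def topspace_eq)
qed

text \<open>
  Since \<open>r\<^sup>m\<close> lies in \<open>D\<close>, division with remainder puts every power of \<open>r\<close> into one of \<open>m\<close> cosets of
  \<open>D\<close>, and a finite union of cosets of a closed subgroup is closed.
\<close>

lemma topgen_subset_cosets:
  assumes D: "subgroup D G" "closedin T D" and r: "r \<in> carrier G" and m: "m > 0" and rm: "r [^] (m::nat) \<in> D"
  shows "topgen G T r \<subseteq> (\<Union>i<m. D #> r [^] i)"
  unfolding topgen_def
proof (rule closure_of_minimal)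
  show "closedin T (\<Union>i<m. D #> r [^] i)"
    using r D(2) by (intro closedin_Union) (auto intro!: closedin_r_coset)
  show "generate G {r} \<subseteq> (\<Union>i<m. D #> r [^] i)"
  proof
    fix x assume "x \<in> generate G {r}"
    then obtain k :: int where x: "x = r [^] k" using generate_pow[OF r] by auto
    define i where "i = nat (k mod int m)"
    have k: "k = int m * (k div int m) + int i" using m by (simp add: i_def)
    have "x = r [^] (int m * (k div int m)) \<otimes> r [^] int i"
      unfolding x by (subst k, subst int_pow_mult[OF r]) simp
    also have "r [^] (int m * (k div int m)) = (r [^] m) [^] (k div int m)"
      using int_pow_pow[OF r, of "int m"] by (simp add: int_pow_int)
    also have "r [^] int i = r [^] i" by (simp add: int_pow_int)
    finally have "x = (r [^] m) [^] (k div int m) \<otimes> r [^] i" .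
    moreover have "(r [^] m) [^] (k div int m) \<in> D" by (rule subgroup_int_pow_closed[OF D(1) rm])
    moreover have "i < m" using m by (simp add: i_def nat_less_iff)
    ultimately show "x \<in> (\<Union>i<m. D #> r [^] i)" by (auto simp: r_coset_def)
  qed
qed

end

section \<open>Profinite groups\<close>

text \<open>
  The finite intersection property for a family of closed sets that is directed downwards.
\<close>

lemma compact_directed_Inter:
  assumes "compact_space X" "\<F> \<noteq> {}" "\<And>A. A \<in> \<F> \<Longrightarrow> closedin X A" "\<And>A. A \<in> \<F> \<Longrightarrow> A \<noteq> {}"
    and dir: "\<And>A B. A \<in> \<F> \<Longrightarrow> B \<in> \<F> \<Longrightarrow> \<exists>C\<in>\<F>. C \<subseteq> A \<inter> B"
  shows "\<Inter>\<F> \<noteq> {}"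
proof -
  have lower: "\<exists>C\<in>\<F>. C \<subseteq> \<Inter>\<G>" if "finite \<G>" "\<G> \<subseteq> \<F>" for \<G>
    using that
  proof (induction \<G> rule: finite_induct)
    case empty
    then show ?case using assms(2) by auto
  next
    case (insert A \<G>)
    then obtain B where B: "B \<in> \<F>" "B \<subseteq> \<Inter>\<G>" by auto
    moreover obtain C where "C \<in> \<F>" "C \<subseteq> A \<inter> B" using dir[of A B] insert.prems B by auto
    ultimately show ?case by (intro bexI[of _ C]) auto
  qed
  have "\<Inter>\<G> \<noteq> {}" if "finite \<G>" "\<G> \<subseteq> \<F>" for \<G>
    using lower[OF that] assms(4) by (metis subset_empty)
  moreover have "\<forall>A\<in>\<F>. closedin X A" using assms(3) by simp
  ultimately show ?thesis
    using assms(1)[unfolded compact_space_fip, THEN spec, of \<F>] by simp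
qed

context profinite_group
begin

text \<open>
  In a compact Hausdorff totally disconnected space points are separated by clopen sets, so \<open>W\<close> may be
  replaced by a clopen \<open>V\<close> with \<open>\<one> \<in> V\<close>. The elements \<open>g\<close> with \<open>V g = V\<close> form a subgroup, which lies in \<open>V\<close>
  because \<open>\<one> \<in> V\<close>. It is open because projecting along the compact factor of \<open>T \<times> T\<close> is a closed map.
\<close>

lemma open_subgroup_basis:
  assumes W: "openin T W" "\<one> \<in> W"
  shows "\<exists>U. subgroup U G \<and> openin T U \<and> U \<subseteq> W"
proof -
  have "separated_between T {\<one>} (topspace T - W)"
  proof (rule cut_wire_fence_theorem[OF compact Hausdorff])
    show "closedin T {\<one>}" using Hausdorff by (simp add: closedin_Hausdorff_sing_eq topspace_eq)
    show "closedin T (topspace T - W)" using W by blast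
    fix C assume "connectedin T C"
    then obtain a where "C \<subseteq> {a}"
      using totally_disconnected unfolding totally_disconnected_space_def by blast
    then show "disjnt C {\<one>} \<or> disjnt C (topspace T - W)"
      using W(2) unfolding disjnt_def by blast
  qed
  then obtain V where V: "closedin T V" "openin T V" "{\<one>} \<subseteq> V" "topspace T - W \<subseteq> topspace T - V"
    unfolding separated_between by blast
  then have VW: "V \<subseteq> W" using openin_subset by fastforce
  have VG: "V \<subseteq> carrier G" using openin_subset[OF V(2)] by (simp add: topspace_eq)
  \<comment> \<open>Half of the stabiliser of \<open>V\<close>: the condition \<open>V g \<subseteq> V\<close>.\<close>
  define S where "S = {g \<in> carrier G. \<forall>v\<in>V. v \<otimes> g \<in> V}"
  have "openin T S"
  proof -
    let ?P = "prod_topology T T"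
    \<comment> \<open>The pairs \<open>(v, g)\<close> witnessing that \<open>g\<close> is not in \<open>S\<close>.\<close>
    let ?B = "{p \<in> topspace ?P. fst p \<in> V} \<inter> {p \<in> topspace ?P. (\<lambda>(x, y). x \<otimes> y) p \<in> topspace T - V}"
    have "closedin ?P ?B"
      by (intro closedin_Int closedin_continuous_map_preimage[OF continuous_map_fst]
          closedin_continuous_map_preimage[OF continuous_mult] closedin_diff V closedin_topspace)
    then have "closedin T (snd ` ?B)"
      using closed_map_snd[OF compact] unfolding closed_map_def by blast
    moreover have "S = topspace T - snd ` ?B"
      using VG by (force simp: S_def topspace_eq)
    ultimately show ?thesis by blast
  qed
  define U where "U = S \<inter> {g \<in> topspace T. inv g \<in> S}"
  have "openin T U"
    unfolding U_def by (intro openin_Int \<open>openin T S\<close> openin_continuous_map_preimage[OF continuous_inv])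
  moreover have "subgroup U G"
  proof
    show "U \<subseteq> carrier G" by (auto simp: U_def S_def)
    show "\<one> \<in> U" using VG by (auto simp: U_def S_def topspace_eq)
    show "inv x \<in> U" if "x \<in> U" for x using that by (auto simp: U_def S_def topspace_eq)
    show "x \<otimes> y \<in> U" if xy: "x \<in> U" "y \<in> U" for x y
    proof -
      have S_mult: "a \<otimes> b \<in> S" if "a \<in> S" "b \<in> S" for a b
      proof -
        have "v \<otimes> (a \<otimes> b) \<in> V" if v: "v \<in> V" for v
        proof -
          have "v \<otimes> (a \<otimes> b) = v \<otimes> a \<otimes> b" using VG v \<open>a \<in> S\<close> \<open>b \<in> S\<close> by (auto simp: S_def m_assoc)
          then show ?thesis using v \<open>a \<in> S\<close> \<open>b \<in> S\<close> by (simp add: S_def)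
        qed
        then show ?thesis using that by (simp add: S_def)
      qed
      have "x \<in> S" "y \<in> S" "inv x \<in> S" "inv y \<in> S" using xy by (auto simp: U_def)
      moreover have "x \<in> carrier G" "y \<in> carrier G" using xy by (auto simp: U_def S_def)
      ultimately show ?thesis
        by (simp add: U_def S_mult topspace_eq inv_mult_group)
    qed
  qed
  moreover have "U \<subseteq> W"
  proof
    fix g assume "g \<in> U"
    then have "\<one> \<otimes> g \<in> V" "g \<in> carrier G" using V(3) by (auto simp: U_def S_def)
    then show "g \<in> W" using VW by auto
  qed
  ultimately show ?thesis by blast
qed

lemma closedin_centralizer_elem:
  assumes "a \<in> carrier G"
  shows "closedin T {x \<in> carrier G. x \<otimes> a = a \<otimes> x}"
proof -
  have "closedin T {x \<in> topspace T. x \<otimes> a = a \<otimes> x}"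
    using assms by (intro closedin_continuous_maps_eq[OF Hausdorff] continuous_map_mult)
      (auto simp: topspace_eq)
  then show ?thesis by (simp add: topspace_eq)
qed

text \<open>
  Centralisers of elements are closed, so commuting with \<open>g\<close> passes from \<open>g\<close> to the closure of the
  group it generates; applying this twice gives the claim.
\<close>

lemma topgen_commute:
  assumes "g \<in> carrier G" "x \<in> topgen G T g" "y \<in> topgen G T g"
  shows "x \<otimes> y = y \<otimes> x"
proof -
  have sub: "topgen G T g \<subseteq> carrier G" using subgroup.subset[OF subgroup_topgen[OF assms(1)]] .
  have *: "topgen G T g \<subseteq> {x \<in> carrier G. x \<otimes> a = a \<otimes> x}" if "a \<in> carrier G" "g \<otimes> a = a \<otimes> g" for a
    using that assms(1) by (intro topgen_subset subgroup_centralizer_elem closedin_centralizer_elem) auto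
  have "g \<otimes> y = y \<otimes> g" using *[of g] assms by force
  then show ?thesis using *[of y] assms sub by force
qed

lemma open_subgroup_finite_cosets:
  assumes "subgroup H G" "openin T H"
  shows "\<exists>F. finite F \<and> F \<subseteq> carrier G \<and> carrier G = (\<Union>f\<in>F. H #> f)"
proof -
  let ?\<U> = "(\<lambda>f. H #> f) ` carrier G"
  have H: "H \<subseteq> carrier G" using assms(1) by (rule subgroup.subset)
  have "topspace T \<subseteq> \<Union>?\<U>" using rcos_self[OF _ assms(1)] by (auto simp: topspace_eq)
  moreover have "Ball ?\<U> (openin T)" using assms(2) openin_r_coset by blast
  ultimately obtain \<F> where \<F>: "finite \<F>" "\<F> \<subseteq> ?\<U>" "topspace T \<subseteq> \<Union>\<F>"
    using compact unfolding compact_space_alt by meson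
  then obtain F where F: "finite F" "F \<subseteq> carrier G" "\<F> = (\<lambda>f. H #> f) ` F"
    using finite_subset_image by meson
  have "(\<Union>f\<in>F. H #> f) \<subseteq> carrier G" using r_coset_subset_G[OF H] F(2) by blast
  moreover have "carrier G \<subseteq> (\<Union>f\<in>F. H #> f)" using \<F>(3) F(3) by (simp add: topspace_eq)
  ultimately have "carrier G = (\<Union>f\<in>F. H #> f)" by simp
  then show ?thesis using F by blast
qed

lemma profinite_subgroup:
  assumes H: "subgroup H G" "closedin T H"
  shows "profinite_group (G\<lparr>carrier := H\<rparr>) (subtopology T H)"
proof -
  let ?K = "G\<lparr>carrier := H\<rparr>" and ?S = "subtopology T H"
  have HG: "H \<subseteq> carrier G" using H(1) by (rule subgroup.subset)
  interpret K: group ?K using H(1) by (rule subgroup_imp_group)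
  have ts: "topspace ?S = H" by (rule topspace_subtopology_subset[OF closedin_subset[OF H(2)]])
  show ?thesis
  proof unfold_locales
    show "topspace ?S = carrier ?K" by (subst ts) simp
    have "continuous_map (prod_topology ?S ?S) T (\<lambda>(x, y). x \<otimes> y)"
      by (simp add: prod_topology_subtopology subtopology_subtopology continuous_map_from_subtopology continuous_mult)
    then show "continuous_map (prod_topology ?S ?S) ?S (\<lambda>(x, y). x \<otimes>\<^bsub>?K\<^esub> y)"
      using H(1) by (auto simp: continuous_map_in_subtopology topspace_prod_topology ts subgroup.m_closed)
    have "continuous_map ?S ?S (\<lambda>x. inv x)"
      using H(1) by (auto simp: continuous_map_in_subtopology ts subgroup.m_inv_closed
          intro: continuous_map_from_subtopology[OF continuous_inv])
    then show "continuous_map ?S ?S (\<lambda>x. inv\<^bsub>?K\<^esub> x)"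
      by (rule continuous_map_eq) (simp add: ts m_inv_consistent[OF H(1)])
    show "compact_space ?S"
      using closedin_compact_space[OF compact H(2)] by (simp add: compact_space_subtopology)
    show "Hausdorff_space ?S" by (rule Hausdorff_space_subtopology[OF Hausdorff])
    show "totally_disconnected_space ?S"
      using totally_disconnected unfolding totally_disconnected_space_def
      by (simp add: connectedin_subtopology)
  qed
qed

lemma topgen_consistent:
  assumes "subgroup H G" "closedin T H" "h \<in> H"
  shows "topgen (G\<lparr>carrier := H\<rparr>) (subtopology T H) h = topgen G T h"
proof -
  have gen: "generate (G\<lparr>carrier := H\<rparr>) {h} = generate G {h}"
    using assms by (intro generate_consistent) auto
  have "generate G {h} \<subseteq> H" using assms by (intro generate_subgroup_incl) auto
  then show ?thesis
    unfolding topgen_def gen closure_of_subtopology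
    using topgen_subset[OF assms] by (simp add: topgen_def Int_absorb1)
qed

text \<open>
  Closures and generated subgroups may be computed inside \<open>G\<close>, so a procyclic subgroup is just the
  closure of a cyclic one. All later arguments use procyclic subgroups in this form.
\<close>

lemma procyclic_subgroup_iff:
  "procyclic_subgroup H G T \<longleftrightarrow> (\<exists>g\<in>carrier G. H = topgen G T g)"
proof
  assume H: "procyclic_subgroup H G T"
  then have sub: "subgroup H G" "closedin T H" by (auto simp: procyclic_subgroup_def)
  from H obtain h where h: "h \<in> H" "topgen (G\<lparr>carrier := H\<rparr>) (subtopology T H) h = H"
    by (auto simp: procyclic_subgroup_def procyclic_def topgen_def)
  then show "\<exists>g\<in>carrier G. H = topgen G T g"
    using topgen_consistent[OF sub h(1)] subgroup.subset[OF sub(1)] by blast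
next
  assume "\<exists>g\<in>carrier G. H = topgen G T g"
  then obtain g where g: "g \<in> carrier G" "H = topgen G T g" by blast
  then have "subgroup H G" "closedin T H" "g \<in> H"
    by (auto simp: subgroup_topgen closedin_topgen topgen_self)
  then show "procyclic_subgroup H G T"
    using topgen_consistent[of H g] profinite_subgroup[of H] g(2)
    by (auto simp: procyclic_subgroup_def procyclic_def topgen_def)
qed

end

section \<open>Procyclic groups and their subgroups of powers\<close>

definition powers :: "('a, 'b) monoid_scheme \<Rightarrow> nat \<Rightarrow> 'a set" where
  "powers G n = (\<lambda>x. x [^]\<^bsub>G\<^esub> n) ` carrier G"

locale procyclic_group = profinite_group +
  fixes z
  assumes z_carrier: "z \<in> carrier G" and z_generates: "topgen G T z = carrier G"

sublocale procyclic_group \<subseteq> comm_group G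
  by unfold_locales (use topgen_commute[OF z_carrier] in \<open>simp add: z_generates\<close>)

context procyclic_group
begin

lemma closed_subgroup_full:
  assumes "subgroup H G" "closedin T H" "z \<in> H"
  shows "H = carrier G"
  using topgen_subset[OF assms] subgroup.subset[OF assms(1)] by (simp add: z_generates)

lemma pow_distrib: "x \<in> carrier G \<Longrightarrow> y \<in> carrier G \<Longrightarrow> (x \<otimes> y) [^] (n::nat) = x [^] n \<otimes> y [^] n"
  by (rule pow_mult_distrib) (simp_all add: m_comm)

lemma powers_subset: "powers G n \<subseteq> carrier G"
  by (auto simp: powers_def)

lemma powersI: "x \<in> carrier G \<Longrightarrow> x [^] n \<in> powers G n"
  by (simp add: powers_def)

lemma subgroup_preimage_pow:
  assumes "subgroup D G"
  shows "subgroup {t \<in> carrier G. t [^] (n::nat) \<in> D} G"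
proof
  show "inv x \<in> {t \<in> carrier G. t [^] n \<in> D}" if "x \<in> {t \<in> carrier G. t [^] n \<in> D}" for x
    using that subgroup.m_inv_closed[OF assms] by (auto simp: nat_pow_inv)
qed (use assms in \<open>auto simp: pow_distrib subgroup.m_closed subgroup.one_closed\<close>)

lemma closedin_preimage_pow:
  assumes "closedin T D"
  shows "closedin T {t \<in> carrier G. t [^] (n::nat) \<in> D}"
  using closedin_continuous_map_preimage[OF continuous_map_pow assms, of n] by (simp add: topspace_eq)

lemma subgroup_powers: "subgroup (powers G n) G"
proof
  show "\<one> \<in> powers G n" using powersI[of \<one> n] by simp
  show "x \<otimes> y \<in> powers G n" if "x \<in> powers G n" "y \<in> powers G n" for x y
    using that by (auto simp: powers_def simp flip: pow_distrib)
  show "inv x \<in> powers G n" if "x \<in> powers G n" for x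
    using that by (auto simp: powers_def simp flip: nat_pow_inv)
qed (rule powers_subset)

lemma closedin_powers: "closedin T (powers G n)"
proof -
  have "compactin T ((\<lambda>x. x [^] n) ` topspace T)"
    using compact unfolding compact_space_def by (rule image_compactin[OF _ continuous_map_pow])
  then show ?thesis
    using compactin_imp_closedin[OF Hausdorff] by (simp add: powers_def topspace_eq)
qed

text \<open>
  The \<open>n\<close>-th powers have finite index: the instance \<open>D = powers G n\<close>, \<open>r = z\<close> of the
  coset bound for topologically generated subgroups.
\<close>

lemma powers_cosets:
  assumes "n > 0"
  shows "carrier G \<subseteq> (\<Union>i<n. powers G n #> z [^] i)"
  using topgen_subset_cosets[OF subgroup_powers closedin_powers z_carrier assms powersI[OF z_carrier]]
  by (simp add: z_generates)

lemma openin_powers: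
  assumes "n > 0"
  shows "openin T (powers G n)"
proof (rule closed_finite_index_openin[OF subgroup_powers closedin_powers])
  show "carrier G \<subseteq> (\<Union>f\<in>(\<lambda>i. z [^] i) ` {..<n}. powers G n #> f)"
    using powers_cosets[OF assms] by simp
qed (auto simp: z_carrier)

text \<open>
  The elements whose \<open>n\<close>-th power lies in \<open>D\<close> form a closed subgroup containing \<open>z\<close>, hence everything.
\<close>

lemma powers_subset_closed:
  assumes D: "subgroup D G" "closedin T D" "z [^] n \<in> D"
  shows "powers G n \<subseteq> D"
proof -
  have "{t \<in> carrier G. t [^] n \<in> D} = carrier G"
    using D z_carrier
    by (intro closed_subgroup_full subgroup_preimage_pow closedin_preimage_pow) auto
  then show ?thesis by (auto simp: powers_def)
qed

lemma powers_mult_subset: "powers G (a * b) \<subseteq> powers G a"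
proof -
  have "x [^] (a * b) \<in> powers G a" if "x \<in> carrier G" for x
  proof -
    have "x [^] (a * b) = (x [^] b) [^] a" using that by (simp add: nat_pow_pow mult.commute)
    then show ?thesis using that by (simp add: powersI)
  qed
  then show ?thesis by (auto simp: powers_def)
qed

lemma powers_dvd_subset: "a dvd b \<Longrightarrow> powers G b \<subseteq> powers G a"
  using powers_mult_subset by (auto elim!: dvdE)

text \<open>
  Two distinct powers of \<open>z\<close> lie in the same one of the finitely many cosets of \<open>E\<close>.
\<close>

lemma open_subgroup_contains_power:
  assumes E: "subgroup E G" "openin T E"
  shows "\<exists>n>0. z [^] (n::nat) \<in> E"
proof -
  obtain F where F: "finite F" "F \<subseteq> carrier G" "carrier G = (\<Union>f\<in>F. E #> f)"
    using open_subgroup_finite_cosets[OF E] by blast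
  have "\<forall>i::nat. \<exists>f\<in>F. z [^] i \<in> E #> f" using F(3) z_carrier by blast
  then obtain c where c: "\<And>i::nat. c i \<in> F \<and> z [^] i \<in> E #> c i" by metis
  then have "finite (range c)" using F(1) by (meson finite_subset image_subsetI)
  then have "\<not> inj c" using finite_imageD infinite_UNIV_nat by blast
  then obtain i j where ij: "i < j" "c i = c j"
    unfolding inj_def by (metis linorder_neqE_nat)
  obtain u v where uv: "u \<in> E" "v \<in> E" "z [^] i = u \<otimes> c j" "z [^] j = v \<otimes> c j"
    using c[of i] c[of j] ij(2) by (auto simp: r_coset_def)
  have carr: "u \<in> carrier G" "v \<in> carrier G" "c j \<in> carrier G"
    using uv c F(2) subgroup.subset[OF E(1)] by auto
  have "z [^] (j - i) \<otimes> z [^] i = z [^] j"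
    using ij(1) z_carrier by (simp add: nat_pow_mult)
  then have "z [^] (j - i) = z [^] j \<otimes> inv (z [^] i)"
    using z_carrier by (metis inv_solve_right nat_pow_closed)
  also have "\<dots> = v \<otimes> c j \<otimes> inv (u \<otimes> c j)" using uv by simp
  also have "\<dots> = v \<otimes> inv u" using carr by (simp add: inv_mult_group m_assoc) (simp add: m_assoc[symmetric])
  also have "\<dots> \<in> E" using uv E(1) by (simp add: subgroup.m_closed subgroup.m_inv_closed)
  finally show ?thesis using ij(1) by (intro exI[of _ "j - i"]) simp
qed

text \<open>
  Here \<open>d\<close> is the least positive exponent with \<open>z\<^sup>d \<in> E\<close>. An element of \<open>E\<close> is a \<open>d\<close>-th power times some
  \<open>z\<^sup>i\<close> with \<open>i < d\<close>, and minimality forces \<open>i = 0\<close>.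
\<close>

lemma open_subgroup_eq_powers:
  assumes E: "subgroup E G" "openin T E"
  shows "\<exists>d>0. E = powers G d \<and> (\<forall>j. z [^] j \<in> E \<longleftrightarrow> d dvd j)"
proof -
  define d where "d = (LEAST n. n > 0 \<and> z [^] (n::nat) \<in> E)"
  have d: "d > 0" "z [^] d \<in> E"
    using LeastI_ex[OF open_subgroup_contains_power[OF E]] by (auto simp: d_def)
  have min: "z [^] n \<notin> E" if "n > 0" "n < d" for n
    using not_less_Least[of n "\<lambda>n. n > 0 \<and> z [^] n \<in> E"] that by (auto simp: d_def)
  have dvd: "z [^] j \<in> E \<longleftrightarrow> d dvd j" for j
  proof
    assume j: "z [^] j \<in> E"
    have "z [^] j = z [^] (d * (j div d)) \<otimes> z [^] (j mod d)" using z_carrier by (simp add: nat_pow_mult)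
    moreover have q: "z [^] (d * (j div d)) \<in> E"
      using nat_pow_closed_subgroup[OF E(1) d(2), of "j div d"] z_carrier by (simp add: nat_pow_pow)
    ultimately have "z [^] (j mod d) = inv (z [^] (d * (j div d))) \<otimes> z [^] j"
      using z_carrier by (simp add: m_assoc[symmetric])
    also have "\<dots> \<in> E" using q j E(1) by (simp add: subgroup.m_closed subgroup.m_inv_closed)
    finally show "d dvd j" using min[of "j mod d"] d(1) by (auto simp: dvd_eq_mod_eq_0)
  next
    assume "d dvd j"
    then obtain k where "j = d * k" by (auto elim: dvdE)
    then show "z [^] j \<in> E"
      using nat_pow_closed_subgroup[OF E(1) d(2), of k] z_carrier by (simp add: nat_pow_pow)
  qed
  have EG: "E \<subseteq> carrier G" using E(1) by (rule subgroup.subset)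
  have "E \<subseteq> powers G d"
  proof
    fix x assume x: "x \<in> E"
    then obtain i where i: "i < d" "x \<in> powers G d #> z [^] i" using powers_cosets[OF d(1)] EG by blast
    then obtain u where u: "u \<in> powers G d" "x = u \<otimes> z [^] i" by (auto simp: r_coset_def)
    have uE: "u \<in> E" using u(1) powers_subset_closed[OF E(1) open_subgroup_closedin[OF E] d(2)] by blast
    then have "z [^] i = inv u \<otimes> x" using u EG z_carrier by (auto simp: m_assoc[symmetric])
    then have "z [^] i \<in> E" using uE x E(1) by (simp add: subgroup.m_closed subgroup.m_inv_closed)
    then have "i = 0" using dvd i(1) by (auto dest: dvd_imp_le)
    then show "x \<in> powers G d" using u subsetD[OF powers_subset u(1)] by simp
  qed
  moreover have "powers G d \<subseteq> E" by (rule powers_subset_closed[OF E(1) open_subgroup_closedin[OF E] d(2)])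
  ultimately show ?thesis using d(1) dvd by blast
qed

lemma powers_basis:
  assumes "openin T W" "\<one> \<in> W"
  shows "\<exists>n>0. powers G n \<subseteq> W"
  using open_subgroup_basis[OF assms] open_subgroup_eq_powers by metis

text \<open>
  Closedness tested along the neighbourhood basis formed by the power subgroups.
\<close>

lemma closedin_limit:
  assumes "closedin T D" "x \<in> carrier G" and meets: "\<And>n. n > 0 \<Longrightarrow> \<exists>u\<in>powers G n. u \<otimes> x \<in> D"
  shows "x \<in> D"
proof (rule ccontr)
  assume "x \<notin> D"
  let ?W = "{w \<in> topspace T. w \<otimes> x \<in> topspace T - D}"
  have "openin T ?W"
    by (rule openin_continuous_map_preimage[OF continuous_map_rmult[OF assms(2)]]) (use assms(1) in blast)
  moreover have "\<one> \<in> ?W" using assms(2) \<open>x \<notin> D\<close> by (simp add: topspace_eq)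
  ultimately obtain n where "n > 0" "powers G n \<subseteq> ?W" using powers_basis by meson
  then show False using meets[of n] by blast
qed

lemma subgroup_mult_powers: "subgroup D G \<Longrightarrow> subgroup (D <#> powers G n) G"
  by (rule mult_subgroups) (simp_all add: subgroup_powers)

lemma powers_subset_mult: "subgroup D G \<Longrightarrow> powers G n \<subseteq> D <#> powers G n"
  using subgroup.one_closed powers_subset by (force simp: set_mult_def)

lemma subset_mult_powers: "subgroup D G \<Longrightarrow> D \<subseteq> D <#> powers G n"
  using subgroup.one_closed[OF subgroup_powers[of n]] subgroup.subset[of D G] by (force simp: set_mult_def)

lemma openin_mult_powers:
  assumes "subgroup D G" "n > 0"
  shows "openin T (D <#> powers G n)"
  using openin_subgroupI[OF subgroup_mult_powers openin_powers _ powers_subset_mult] assms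
    subgroup.one_closed[OF subgroup_powers[of n]] by blast

end

section \<open>Closed subgroups and the coprime part\<close>

text \<open>
  In a procyclic group, a product of its Sylow subgroups, this is for \<open>m > 0\<close> the product of those
  belonging to primes that do not divide \<open>m\<close>. The description by powers avoids the Sylow decomposition.
\<close>

definition coprime_part :: "('a, 'b) monoid_scheme \<Rightarrow> nat \<Rightarrow> 'a set" where
  "coprime_part G m = (\<Inter>k. powers G (m ^ k))"

context procyclic_group
begin

text \<open>
  The sets \<open>A \<inter> X n\<close> are directed because \<open>X (a b)\<close> lies in both \<open>X a\<close> and \<open>X b\<close>. This replaces the
  inverse limit over the finite quotients \<open>G / powers G n\<close>: a condition that can be met in each of them
  can be met in \<open>G\<close>.
\<close>

lemma divisibility_limit:
  assumes "closedin T A" and closed: "\<And>n. n > 0 \<Longrightarrow> closedin T (X n)"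
    and meets: "\<And>n. n > 0 \<Longrightarrow> A \<inter> X n \<noteq> {}"
    and dec: "\<And>a b::nat. a dvd b \<Longrightarrow> X b \<subseteq> X a"
  shows "\<exists>x\<in>A. \<forall>n>0. x \<in> X n"
proof -
  let ?\<F> = "(\<lambda>n. A \<inter> X n) ` {n. n > 0}"
  have "\<Inter>?\<F> \<noteq> {}"
  proof (rule compact_directed_Inter[OF compact])
    have "A \<inter> X 1 \<in> ?\<F>" by blast
    then show "?\<F> \<noteq> {}" by blast
    fix C B assume "C \<in> ?\<F>" "B \<in> ?\<F>"
    then obtain a b where ab: "a > 0" "b > 0" "C = A \<inter> X a" "B = A \<inter> X b" by auto
    then show "\<exists>D\<in>?\<F>. D \<subseteq> C \<inter> B"
      using dec[of a "a * b"] dec[of b "a * b"] by (intro bexI[of _ "A \<inter> X (a * b)"]) auto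
  qed (use closed meets assms(1) in auto)
  then obtain x where x: "x \<in> \<Inter>?\<F>" by blast
  then have "x \<in> A \<inter> X n" if "n > 0" for n using that by blast
  then show ?thesis using zero_less_one by blast
qed

text \<open>
  The condition says that \<open>p\<close> lies in the group generated by \<open>w s\<close> modulo \<open>n\<close>-th powers; it depends only
  on the coset of \<open>s\<close> modulo \<open>n\<close>-th powers.
\<close>

lemma closedin_powers_approximable:
  assumes n: "n > 0" and p: "p \<in> carrier G" and w: "w \<in> carrier G"
  shows "closedin T {s \<in> carrier G. \<exists>i::nat. p \<otimes> inv ((w \<otimes> s) [^] i) \<in> powers G n}" (is "closedin T ?Y")
proof (rule closedin_if_stable[OF subgroup_powers openin_powers[OF n]])
  fix u x assume u: "u \<in> powers G n" and x: "x \<in> ?Y"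
  have carr: "u \<in> carrier G" "x \<in> carrier G" using u powers_subset x by auto
  obtain i :: nat where i: "p \<otimes> inv ((w \<otimes> x) [^] i) \<in> powers G n" using x by auto
  have ui: "inv (u [^] i) \<in> powers G n"
    by (intro subgroup.m_inv_closed[OF subgroup_powers] nat_pow_closed_subgroup subgroup_powers u)
  have "p \<otimes> inv ((w \<otimes> x) [^] i) \<otimes> inv (u [^] i) \<in> powers G n"
    by (rule subgroup.m_closed[OF subgroup_powers i ui])
  moreover have "w \<otimes> (u \<otimes> x) = u \<otimes> (w \<otimes> x)" using carr w by (intro m_lcomm) auto
  then have "p \<otimes> inv ((w \<otimes> x) [^] i) \<otimes> inv (u [^] i) = p \<otimes> inv ((w \<otimes> (u \<otimes> x)) [^] i)"
    using carr p w by (simp add: pow_distrib[of u] inv_mult_group m_assoc)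
  ultimately show "u \<otimes> x \<in> ?Y" using carr by auto
qed auto

lemma in_topgenI:
  assumes h: "h \<in> carrier G" and y: "y \<in> carrier G"
    and approx: "\<And>n. n > 0 \<Longrightarrow> \<exists>i::nat. y \<otimes> inv (h [^] i) \<in> powers G n"
  shows "y \<in> topgen G T h"
proof (rule closedin_limit[OF closedin_topgen y])
  fix n :: nat assume "n > 0"
  then obtain i :: nat where i: "y \<otimes> inv (h [^] i) \<in> powers G n" using approx by blast
  let ?u = "inv (y \<otimes> inv (h [^] i))"
  have "?u \<in> powers G n" using i by (rule subgroup.m_inv_closed[OF subgroup_powers])
  moreover have "?u \<otimes> y = h [^] i" using h y by (simp add: inv_mult_group m_assoc)
  moreover have "h [^] i \<in> topgen G T h" by (intro nat_pow_closed_subgroup subgroup_topgen topgen_self h)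
  ultimately show "\<exists>u\<in>powers G n. u \<otimes> y \<in> topgen G T h" by metis
qed

text \<open>
  Modulo \<open>n\<close>-th powers, \<open>H\<close> becomes a subgroup of a finite cyclic group and so is generated by a single
  element; a compactness argument yields one \<open>h \<in> H\<close> that works for all \<open>n\<close> simultaneously.
\<close>

lemma closed_subgroup_procyclic:
  assumes H: "subgroup H G" "closedin T H"
  shows "\<exists>r\<in>H. H = topgen G T r"
proof -
  have HG: "H \<subseteq> carrier G" using H(1) by (rule subgroup.subset)
  define X where "X n = {h \<in> carrier G. \<forall>y\<in>H. \<exists>i::nat. y \<otimes> inv (h [^] i) \<in> powers G n}" for n
  have X_closed: "closedin T (X n)" if "n > 0" for n
  proof -
    let ?Y = "\<lambda>y. {s \<in> carrier G. \<exists>i::nat. y \<otimes> inv ((\<one> \<otimes> s) [^] i) \<in> powers G n}"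
    have "closedin T (\<Inter>(?Y ` H))"
    proof (rule closedin_Inter)
      show "?Y ` H \<noteq> {}" using subgroup.one_closed[OF H(1)] by blast
    qed (use that HG closedin_powers_approximable in blast)
    moreover have "?Y y = {s \<in> carrier G. \<exists>i::nat. y \<otimes> inv (s [^] i) \<in> powers G n}" for y
      by (auto cong: conj_cong)
    then have "X n = \<Inter>(?Y ` H)"
      using subgroup.one_closed[OF H(1)] by (auto simp: X_def)
    ultimately show ?thesis by simp
  qed
  have X_nonempty: "H \<inter> X n \<noteq> {}" if n: "n > 0" for n
  proof -
    let ?E = "H <#> powers G n"
    obtain d where d: "d > 0" "?E = powers G d" "\<And>j. z [^] j \<in> ?E \<longleftrightarrow> d dvd j"
      using open_subgroup_eq_powers[OF subgroup_mult_powers[OF H(1)] openin_mult_powers[OF H(1) n]] by blast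
    have "z [^] d \<in> ?E" using d(3) by simp
    then obtain h u where h: "h \<in> H" "u \<in> powers G n" "z [^] d = h \<otimes> u" by (auto simp: set_mult_def)
    have carr: "h \<in> carrier G" "u \<in> carrier G" using h HG powers_subset by auto
    have "\<exists>i::nat. y \<otimes> inv (h [^] i) \<in> powers G n" if y: "y \<in> H" for y
    proof -
      have "y \<in> powers G d" using y subset_mult_powers[OF H(1), of n] d(2) by blast
      then obtain w where w: "w \<in> carrier G" "y = w [^] d" by (auto simp: powers_def)
      obtain i :: nat where "w \<in> powers G n #> z [^] i" using powers_cosets[OF n] w(1) by blast
      then obtain v where i: "v \<in> powers G n" "w = v \<otimes> z [^] i" by (auto simp: r_coset_def)
      have v: "v \<in> carrier G" using i(1) powers_subset by blast
      have "y = v [^] d \<otimes> (z [^] d) [^] i"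
        using w i v z_carrier by (simp add: pow_distrib nat_pow_pow mult.commute)
      also have "\<dots> = v [^] d \<otimes> u [^] i \<otimes> h [^] i"
        using h(3) carr v by (simp add: pow_distrib m_ac)
      finally have "y \<otimes> inv (h [^] i) = v [^] d \<otimes> u [^] i"
        using carr v by (simp add: m_assoc)
      also have "\<dots> \<in> powers G n"
        by (intro subgroup.m_closed[OF subgroup_powers] nat_pow_closed_subgroup subgroup_powers i(1) h(2))
      finally show ?thesis by blast
    qed
    then show ?thesis using h(1) carr by (auto simp: X_def)
  qed
  have "\<exists>h\<in>H. \<forall>n>0. h \<in> X n"
  proof (intro divisibility_limit H(2) X_closed X_nonempty)
    show "X b \<subseteq> X a" if "a dvd b" for a b
      using powers_dvd_subset[OF that] unfolding X_def by blast
  qed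
  then obtain h where h: "h \<in> H" "\<And>n. n > 0 \<Longrightarrow> h \<in> X n" by blast
  have "H \<subseteq> topgen G T h"
  proof
    fix y assume "y \<in> H"
    then show "y \<in> topgen G T h" using h HG by (intro in_topgenI) (auto simp: X_def)
  qed
  then show ?thesis using topgen_subset[OF H h(1)] h(1) by blast
qed

text \<open>
  The \<open>m\<close>-th roots of \<open>D\<close> form a closed subgroup, which is topologically generated by some \<open>r\<close> with
  \<open>r\<^sup>m \<in> D\<close>; so the powers \<open>r\<^sup>i\<close> with \<open>i < m\<close> represent all cosets. For \<open>D = {\<one>}\<close> this is the finiteness of the
  \<open>m\<close>-torsion.
\<close>

lemma roots_finite_mod_closed_subgroup:
  assumes D: "subgroup D G" "closedin T D" and m: "m > 0"
  shows "\<exists>F. finite F \<and> F \<subseteq> {t \<in> carrier G. t [^] (m::nat) \<in> D} \<and>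
    {t \<in> carrier G. t [^] m \<in> D} \<subseteq> (\<Union>f\<in>F. D #> f)"
proof -
  let ?R = "{t \<in> carrier G. t [^] m \<in> D}"
  have sub: "subgroup ?R G" by (rule subgroup_preimage_pow[OF D(1)])
  obtain r where r: "r \<in> ?R" "?R = topgen G T r"
    using closed_subgroup_procyclic[OF sub closedin_preimage_pow[OF D(2)]] by blast
  have "?R \<subseteq> (\<Union>i<m. D #> r [^] i)"
    using topgen_subset_cosets[OF D, of r m] r m by auto
  moreover have "r [^] i \<in> ?R" for i :: nat
    by (rule nat_pow_closed_subgroup[OF sub r(1)])
  ultimately show ?thesis by (intro exI[of _ "(\<lambda>i. r [^] i) ` {..<m}"]) auto
qed

lemma subgroup_coprime_part: "subgroup (coprime_part G m) G"
  unfolding coprime_part_def by (rule subgroups_Inter) (auto simp: subgroup_powers)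

lemma closedin_coprime_part: "closedin T (coprime_part G m)"
  unfolding coprime_part_def by (intro closedin_Inter) (auto simp: closedin_powers)

lemma coprime_part_subset_powers: "coprime_part G m \<subseteq> powers G (m ^ k)"
  by (auto simp: coprime_part_def)

lemma compact_coprime_part_limit:
  assumes closed: "\<And>k. closedin T (A k)" and ne: "\<And>k. A k \<inter> powers G (m ^ k) \<noteq> {}"
    and dec: "\<And>k. A (Suc k) \<subseteq> A k"
  shows "(\<Inter>k. A k) \<inter> coprime_part G m \<noteq> {}"
proof -
  have "(\<Inter>k. A k \<inter> powers G (m ^ k)) \<noteq> {}"
  proof (rule compact_space_imp_nest[OF compact])
    show "decseq (\<lambda>k. A k \<inter> powers G (m ^ k))"
      unfolding decseq_Suc_iff using dec powers_dvd_subset[of "m ^ k" "m ^ Suc k" for k] by fastforce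
  qed (use closed ne closedin_powers in auto)
  then show ?thesis by (auto simp: coprime_part_def)
qed

text \<open>
  For every \<open>k\<close> some \<open>m^k\<close>-th power is an \<open>m\<close>-th root of \<open>q\<close>; these roots accumulate at a root in the
  intersection.
\<close>

lemma coprime_part_divisible:
  assumes "q \<in> coprime_part G m"
  shows "\<exists>s\<in>coprime_part G m. s [^] m = q"
proof -
  let ?A = "{s \<in> topspace T. s [^] m = q}"
  have qG: "q \<in> carrier G" using assms subgroup.subset[OF subgroup_coprime_part] by blast
  have "(\<Inter>k::nat. ?A) \<inter> coprime_part G m \<noteq> {}"
  proof (rule compact_coprime_part_limit)
    show "closedin T ?A" 
      using qG by (intro closedin_continuous_maps_eq[OF Hausdorff continuous_map_pow]) (simp add: topspace_eq)
    fix k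
    obtain y where y: "y \<in> carrier G" "q = y [^] (m ^ Suc k)"
      using assms coprime_part_subset_powers[of m "Suc k"] by (auto simp: powers_def)
    then have "y [^] (m ^ k) \<in> ?A \<inter> powers G (m ^ k)"
      by (simp add: topspace_eq powersI nat_pow_pow mult.commute)
    then show "?A \<inter> powers G (m ^ k) \<noteq> {}" by blast
  qed simp
  then show ?thesis by auto
qed

lemma coprime_part_divisible_power:
  assumes "q \<in> coprime_part G m"
  shows "\<exists>s\<in>coprime_part G m. s [^] (m ^ k) = q"
  using assms
proof (induction k arbitrary: q)
  case 0
  then show ?case using subgroup.subset[OF subgroup_coprime_part[of m]] by (intro bexI[of _ q]) auto
next
  case (Suc k)
  obtain s where s: "s \<in> coprime_part G m" "s [^] m = q" using coprime_part_divisible[OF Suc.prems] by blast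
  obtain t where t: "t \<in> coprime_part G m" "t [^] (m ^ k) = s" using Suc.IH[OF s(1)] by blast
  have "t \<in> carrier G" using t(1) subgroup.subset[OF subgroup_coprime_part] by blast
  then have "t [^] (m ^ Suc k) = (t [^] (m ^ k)) [^] m" by (simp add: nat_pow_pow mult.commute)
  then have "t [^] (m ^ Suc k) = q" using s(2) t(2) by simp
  then show ?case using t(1) by blast
qed

text \<open>
  Otherwise compactness would give a point of the coprime part outside this open subgroup.
\<close>

lemma powers_subset_coprime_part_mult:
  assumes "n > 0"
  shows "\<exists>k. powers G (m ^ k) \<subseteq> coprime_part G m <#> powers G n"
proof (rule ccontr)
  assume no: "\<not> ?thesis"
  let ?E = "coprime_part G m <#> powers G n"
  have "(\<Inter>k::nat. topspace T - ?E) \<inter> coprime_part G m \<noteq> {}"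
  proof (rule compact_coprime_part_limit)
    show "closedin T (topspace T - ?E)"
      by (intro closedin_diff closedin_topspace openin_mult_powers subgroup_coprime_part assms)
    show "(topspace T - ?E) \<inter> powers G (m ^ k) \<noteq> {}" for k
      using no powers_subset[of "m ^ k"] by (auto simp: topspace_eq)
  qed simp
  then show False using subset_mult_powers[OF subgroup_coprime_part, of m n] by blast
qed

text \<open>
  Let \<open>p\<close> generate \<open>coprime_part G m\<close>. Modulo \<open>n\<close>-th powers, \<open>w\<close> raised to a high power \<open>m^k\<close> becomes an
  element \<open>q\<close> of the coprime part, and divisibility provides \<open>s\<close> with \<open>s\<close> to the power \<open>m^k\<close> equal to
  \<open>q\<inverse> p\<close>, so that \<open>w s\<close> to the power \<open>m^k\<close> is \<open>p\<close>. Compactness gives one \<open>s\<close> for all \<open>n\<close>.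
\<close>

lemma translate_generating_coprime_part:
  assumes w: "w \<in> carrier G"
  shows "\<exists>s\<in>coprime_part G m. coprime_part G m \<subseteq> topgen G T (w \<otimes> s)"
proof -
  let ?P = "coprime_part G m"
  have PG: "?P \<subseteq> carrier G" by (rule subgroup.subset[OF subgroup_coprime_part])
  obtain p where p: "p \<in> ?P" "?P = topgen G T p"
    using closed_subgroup_procyclic[OF subgroup_coprime_part closedin_coprime_part] by blast
  have pG: "p \<in> carrier G" using p PG by blast
  define Y where "Y n = {s \<in> carrier G. \<exists>i::nat. p \<otimes> inv ((w \<otimes> s) [^] i) \<in> powers G n}" for n
  have Y_closed: "closedin T (Y n)" if "n > 0" for n
    unfolding Y_def by (rule closedin_powers_approximable[OF that pG w])
  have Y_nonempty: "?P \<inter> Y n \<noteq> {}" if n: "n > 0" for n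
  proof -
    obtain k where k: "powers G (m ^ k) \<subseteq> ?P <#> powers G n" using powers_subset_coprime_part_mult[OF n] by blast
    then have "w [^] (m ^ k) \<in> ?P <#> powers G n" using powersI[OF w] by blast
    then obtain q u where q: "q \<in> ?P" "u \<in> powers G n" "w [^] (m ^ k) = q \<otimes> u" by (auto simp: set_mult_def)
    have carr: "q \<in> carrier G" "u \<in> carrier G" using q PG powers_subset by auto
    have "inv q \<otimes> p \<in> ?P"
      using q(1) p(1) by (simp add: subgroup.m_closed[OF subgroup_coprime_part] subgroup.m_inv_closed[OF subgroup_coprime_part])
    then obtain s where s: "s \<in> ?P" "s [^] (m ^ k) = inv q \<otimes> p" using coprime_part_divisible_power by blast
    have sG: "s \<in> carrier G" using s PG by blast
    have "(w \<otimes> s) [^] (m ^ k) = q \<otimes> u \<otimes> (inv q \<otimes> p)" using w sG q(3) s(2) by (simp add: pow_distrib)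
    also have "\<dots> = q \<otimes> (inv q \<otimes> (u \<otimes> p))" using carr pG by (simp add: m_assoc m_lcomm[of u "inv q"])
    also have "\<dots> = u \<otimes> p" using carr pG by (simp add: m_assoc[symmetric])
    finally have "p \<otimes> inv ((w \<otimes> s) [^] (m ^ k)) = inv u"
      using carr pG by (simp add: inv_mult_group m_assoc[symmetric])
    then have "p \<otimes> inv ((w \<otimes> s) [^] (m ^ k)) \<in> powers G n"
      using q(2) by (simp add: subgroup.m_inv_closed[OF subgroup_powers])
    then show ?thesis using s(1) sG by (auto simp: Y_def)
  qed
  have "\<exists>s\<in>?P. \<forall>n>0. s \<in> Y n"
  proof (intro divisibility_limit closedin_coprime_part Y_closed Y_nonempty)
    show "Y b \<subseteq> Y a" if "a dvd b" for a b
      using powers_dvd_subset[OF that] unfolding Y_def by blast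
  qed
  then obtain s where s: "s \<in> ?P" "\<And>n. n > 0 \<Longrightarrow> s \<in> Y n" by blast
  have sG: "w \<otimes> s \<in> carrier G" using s PG w by blast
  have "p \<in> topgen G T (w \<otimes> s)" using s(2) by (intro in_topgenI sG pG) (auto simp: Y_def)
  then have "?P \<subseteq> topgen G T (w \<otimes> s)"
    using topgen_subset[OF subgroup_topgen[OF sG] closedin_topgen] p(2) by simp
  then show ?thesis using s(1) by blast
qed

text \<open>
  If \<open>t\<close> lies in the intersection, the coset of \<open>D\<close> containing \<open>t\<close> meets each \<open>powers G (m^k)\<close>, hence by
  compactness their intersection, which is contained in \<open>D\<close>.
\<close>

lemma closed_subgroup_eq_Inter_mult_powers:
  assumes D: "subgroup D G" "closedin T D" and coprime_part: "coprime_part G m \<subseteq> D"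
  shows "D = (\<Inter>k. D <#> powers G (m ^ k))"
proof
  show "D \<subseteq> (\<Inter>k. D <#> powers G (m ^ k))" using subset_mult_powers[OF D(1)] by blast
  have DG: "D \<subseteq> carrier G" using D(1) by (rule subgroup.subset)
  show "(\<Inter>k. D <#> powers G (m ^ k)) \<subseteq> D"
  proof
    fix t assume t: "t \<in> (\<Inter>k. D <#> powers G (m ^ k))"
    then have "t \<in> D <#> powers G (m ^ 0)" by blast
    then have tG: "t \<in> carrier G" using subgroup.subset[OF subgroup_mult_powers[OF D(1)]] by blast
    let ?A = "{s \<in> topspace T. t \<otimes> inv s \<in> D}"
    have "(\<Inter>k::nat. ?A) \<inter> coprime_part G m \<noteq> {}"
    proof (rule compact_coprime_part_limit)
      have "continuous_map T T (\<lambda>s. t \<otimes> inv s)"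
        using tG by (intro continuous_map_mult continuous_inv) (simp add: topspace_eq)
      then show "closedin T ?A" by (rule closedin_continuous_map_preimage[OF _ D(2)])
      fix k
      have "t \<in> D <#> powers G (m ^ k)" using t by blast
      then obtain q u where q: "q \<in> D" "u \<in> powers G (m ^ k)" "t = q \<otimes> u" by (auto simp: set_mult_def)
      have carr: "q \<in> carrier G" "u \<in> carrier G" using q DG powers_subset by auto
      then have "t \<otimes> inv u = q" using q(3) by (simp add: m_assoc)
      then have "u \<in> ?A \<inter> powers G (m ^ k)" using q carr by (simp add: topspace_eq)
      then show "?A \<inter> powers G (m ^ k) \<noteq> {}" by blast
    qed simp
    then obtain s where s: "s \<in> coprime_part G m" "t \<otimes> inv s \<in> D" by blast
    then have "t \<otimes> inv s \<otimes> s \<in> D" using coprime_part subgroup.m_closed[OF D(1)] by blast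
    moreover have "t \<otimes> inv s \<otimes> s = t" using tG s(1) coprime_part DG by (simp add: m_assoc subset_iff)
    ultimately show "t \<in> D" by simp
  qed
qed

text \<open>
  The open subgroups \<open>E k = D powers G (m^k)\<close> decrease to \<open>D\<close>. Write \<open>E k\<close> as \<open>powers G (d k)\<close> and let
  \<open>r k\<close> be the index of \<open>E (k + 1)\<close> in \<open>E k\<close>. Taking \<open>m\<close>-th powers maps the quotient of \<open>E k\<close> by \<open>E (k + 1)\<close>
  onto the next one, so \<open>r (k + 1)\<close> divides \<open>r k\<close>. The sequence \<open>r\<close> is therefore eventually constant, and from
  that point on \<open>d\<close> is a geometric progression.
\<close>

lemma closed_subgroup_over_coprime_part:
  assumes D: "subgroup D G" "closedin T D" and coprime_part: "coprime_part G m \<subseteq> D" and m: "m > 0"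
  shows "\<exists>a r. D = (\<Inter>j. powers G (a * r ^ j))"
proof -
  define E where "E k = D <#> powers G (m ^ k)" for k
  have DG: "D \<subseteq> carrier G" using D(1) by (rule subgroup.subset)
  have sub: "subgroup (E k) G" for k unfolding E_def by (rule subgroup_mult_powers[OF D(1)])
  have EI: "q \<otimes> u \<in> E k" if "q \<in> D" "u \<in> powers G (m ^ k)" for q u k
    using that by (auto simp: E_def set_mult_def)
  have EE: "\<exists>q u. q \<in> D \<and> u \<in> powers G (m ^ k) \<and> x = q \<otimes> u" if "x \<in> E k" for x k
    using that by (auto simp: E_def set_mult_def)
  have DE: "D \<subseteq> E k" for k unfolding E_def by (rule subset_mult_powers[OF D(1)])
  have dec: "E (Suc k) \<subseteq> E k" for k
    using powers_dvd_subset[of "m ^ k" "m ^ Suc k"] by (auto simp: E_def set_mult_def)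
  have pow_m: "e [^] m \<in> E (Suc k)" if e: "e \<in> E k" for e k
  proof -
    obtain q u where q: "q \<in> D" "u \<in> powers G (m ^ k)" "e = q \<otimes> u" using EE[OF e] by blast
    obtain v where v: "v \<in> carrier G" "u = v [^] (m ^ k)" using q(2) by (auto simp: powers_def)
    have "u [^] m = v [^] (m ^ Suc k)" using v by (simp add: nat_pow_pow mult.commute)
    then have "u [^] m \<in> powers G (m ^ Suc k)" using v(1) powersI by simp
    moreover have "q [^] m \<in> D" by (rule nat_pow_closed_subgroup[OF D(1) q(1)])
    moreover have "e [^] m = q [^] m \<otimes> u [^] m"
      using q DG powers_subset by (simp add: pow_distrib subset_iff)
    ultimately show ?thesis using EI by simp
  qed
  have "\<forall>k. \<exists>d>0. E k = powers G d \<and> (\<forall>j. z [^] j \<in> E k \<longleftrightarrow> d dvd j)"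
    using open_subgroup_eq_powers[OF subgroup_mult_powers openin_mult_powers] D(1) m
    unfolding E_def by simp
  then obtain d where d: "\<And>k. d k > 0" "\<And>k. E k = powers G (d k)" "\<And>k j. z [^] j \<in> E k \<longleftrightarrow> d k dvd j"
    by metis
  have d_dvd: "d k dvd d (Suc k)" for k using d(3) dec by (meson dvd_refl subsetD)
  define r where "r k = d (Suc k) div d k" for k
  have dr: "d (Suc k) = d k * r k" for k using d_dvd by (simp add: r_def)
  have r_pos: "r k > 0" for k using d(1)[of "Suc k"] dr[of k] by (simp add: zero_less_mult_iff)
  have r_dvd: "r (Suc k) dvd r k" for k
  proof -
    have "z [^] d (Suc k) \<in> E (Suc k)" using d(3) by simp
    then obtain q u where q: "q \<in> D" "u \<in> powers G (m ^ Suc k)" "z [^] d (Suc k) = q \<otimes> u" using EE by blast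
    obtain s where s: "s \<in> carrier G" "u = s [^] (m ^ Suc k)" using q(2) by (auto simp: powers_def)
    have "s [^] (m ^ k) \<in> E k"
      using EI[OF subgroup.one_closed[OF D(1)] powersI[OF s(1)], of k] s(1) by simp
    then obtain w where w: "w \<in> carrier G" "s [^] (m ^ k) = w [^] d k" by (auto simp: d(2) powers_def)
    have "u [^] r k = (s [^] (m ^ k)) [^] (m * r k)" using s by (simp add: nat_pow_pow mult_ac)
    also have "\<dots> = (w [^] d (Suc k)) [^] m" using w dr by (simp add: nat_pow_pow mult_ac)
    also have "\<dots> \<in> E (Suc (Suc k))" using powersI[OF w(1)] d(2) by (intro pow_m) simp
    finally have "u [^] r k \<in> E (Suc (Suc k))" .
    moreover have "q [^] r k \<in> E (Suc (Suc k))" using nat_pow_closed_subgroup[OF D(1) q(1)] DE by blast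
    moreover have "z [^] (d (Suc k) * r k) = q [^] r k \<otimes> u [^] r k"
    proof -
      have "q \<in> carrier G" "u \<in> carrier G" using q DG powers_subset by auto
      then have "q [^] r k \<otimes> u [^] r k = (z [^] d (Suc k)) [^] r k" using q(3) by (simp add: pow_distrib)
      then show ?thesis using z_carrier by (simp add: nat_pow_pow)
    qed
    ultimately have "z [^] (d (Suc k) * r k) \<in> E (Suc (Suc k))"
      using subgroup.m_closed[OF sub] by simp
    then have "d (Suc k) * r (Suc k) dvd d (Suc k) * r k" using d(3) dr[of "Suc k"] by simp
    then show ?thesis using d(1)[of "Suc k"] by simp
  qed
  have r_anti: "r (k + j) \<le> r k" for k j
  proof (induction j)
    case (Suc j)
    then show ?case using dvd_imp_le[OF r_dvd r_pos, of "k + j"] by simp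
  qed simp
  obtain K where K: "\<And>k. r K \<le> r k" using ex_has_least_nat[of "\<lambda>_. True" 0 r] by auto
  have "r (K + j) = r K" for j using r_anti K by (simp add: le_antisym)
  then have "d (K + j) = d K * r K ^ j" for j by (induction j) (simp_all add: dr)
  then have EK: "E (K + j) = powers G (d K * r K ^ j)" for j by (simp add: d(2))
  have "E (k + j) \<subseteq> E k" for k j using dec by (induction j) fastforce+
  then have "E (K + k) \<subseteq> E k" for k by (metis add.commute)
  then have "(\<Inter>k. E k) = (\<Inter>j. E (K + j))" by blast
  then have "D = (\<Inter>j. powers G (d K * r K ^ j))"
    using closed_subgroup_eq_Inter_mult_powers[OF D coprime_part] EK by (simp add: E_def)
  then show ?thesis by blast
qed

lemma countable_closed_subgroups_over_coprime_part:
  assumes "m > 0"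
  shows "countable {D. subgroup D G \<and> closedin T D \<and> coprime_part G m \<subseteq> D}"
proof (rule countable_subset)
  show "{D. subgroup D G \<and> closedin T D \<and> coprime_part G m \<subseteq> D}
      \<subseteq> range (\<lambda>(a, r). \<Inter>j. powers G (a * r ^ j))"
    using closed_subgroup_over_coprime_part[OF _ _ _ assms] by (auto simp: image_iff)
qed simp

end

section \<open>Covering a group with an open central procyclic subgroup\<close>

context profinite_group
begin

lemma procyclic_group_topgen:
  assumes g: "g \<in> carrier G"
  shows "procyclic_group (G\<lparr>carrier := topgen G T g\<rparr>) (subtopology T (topgen G T g)) g"
proof -
  interpret K: profinite_group "G\<lparr>carrier := topgen G T g\<rparr>" "subtopology T (topgen G T g)"
    by (rule profinite_subgroup[OF subgroup_topgen[OF g] closedin_topgen])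
  show ?thesis
    by unfold_locales
      (simp_all add: topgen_self[OF g] topgen_consistent[OF subgroup_topgen[OF g] closedin_topgen topgen_self[OF g]])
qed

lemma closed_subgroup_of_topgen:
  assumes H: "subgroup H G" "closedin T H" and g: "g \<in> carrier G" and sub: "H \<subseteq> topgen G T g"
  shows "\<exists>r\<in>H. H = topgen G T r"
proof -
  interpret C: procyclic_group "G\<lparr>carrier := topgen G T g\<rparr>" "subtopology T (topgen G T g)" g
    by (rule procyclic_group_topgen[OF g])
  have "closedin (subtopology T (topgen G T g)) H"
    using H(2) sub by (simp add: closedin_closed_subtopology closedin_topgen)
  then obtain r where r: "r \<in> H" "H = topgen (G\<lparr>carrier := topgen G T g\<rparr>) (subtopology T (topgen G T g)) r"
    using C.closed_subgroup_procyclic[OF subgroup_incl[OF H(1) subgroup_topgen[OF g] sub]] by blast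
  then have "H = topgen G T r"
    using topgen_consistent[OF subgroup_topgen[OF g] closedin_topgen, of r] sub by auto
  then show ?thesis using r(1) by blast
qed

lemma topgen_eq_closure_insert:
  assumes y: "y \<in> carrier G" and D: "D \<subseteq> topgen G T y"
  shows "topgen G T y = Abstract_Topology.closure_of T (generate G (insert y D))"
proof
  show "topgen G T y \<subseteq> Abstract_Topology.closure_of T (generate G (insert y D))"
    unfolding topgen_def by (intro closure_of_mono mono_generate) auto
  show "Abstract_Topology.closure_of T (generate G (insert y D)) \<subseteq> topgen G T y"
    using D topgen_self[OF y]
    by (intro closure_of_minimal closedin_topgen generate_subgroup_incl subgroup_topgen y) auto
qed

end

text \<open>
  The common ground between the two sides of the equivalence: an open central procyclic subgroup,
  given by a topological generator.
\<close>

locale central_procyclic = profinite_group +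
  fixes z
  assumes z_carrier: "z \<in> carrier G" and open_topgen: "openin T (topgen G T z)"
    and central: "x \<in> carrier G \<Longrightarrow> t \<in> topgen G T z \<Longrightarrow> x \<otimes> t = t \<otimes> x"
begin

abbreviation Z where "Z \<equiv> topgen G T z"
abbreviation GZ where "GZ \<equiv> G\<lparr>carrier := Z\<rparr>"

sublocale Z: procyclic_group GZ "subtopology T Z" z
  by (rule procyclic_group_topgen[OF z_carrier])

lemma subgroup_Z: "subgroup Z G" by (rule subgroup_topgen[OF z_carrier])

lemma Z_subset: "Z \<subseteq> carrier G" by (rule subgroup.subset[OF subgroup_Z])

lemma carrier_GZ: "carrier GZ = Z" by simp

lemma pow_GZ: "t [^]\<^bsub>GZ\<^esub> (n::nat) = t [^] n" by (rule nat_pow_consistent[symmetric])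

lemma r_coset_GZ: "D #>\<^bsub>GZ\<^esub> f = D #> f" by (simp add: r_coset_def)

lemma normal_Z: "Z \<lhd> G"
  unfolding normal_inv_iff
proof (intro conjI ballI subgroup_Z)
  fix x h assume xh: "x \<in> carrier G" "h \<in> Z"
  then have hG: "h \<in> carrier G" using Z_subset by blast
  have "x \<otimes> h \<otimes> inv x = h \<otimes> x \<otimes> inv x" using central xh by simp
  also have "\<dots> = h" using xh(1) hG by (simp add: m_assoc)
  finally show "x \<otimes> h \<otimes> inv x \<in> Z" using xh(2) by simp
qed

lemma finite_quotient: "finite (rcosets Z)"
proof -
  obtain F where F: "finite F" "F \<subseteq> carrier G" "carrier G = (\<Union>f\<in>F. Z #> f)"
    using open_subgroup_finite_cosets[OF subgroup_Z open_topgen] by blast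
  have "rcosets Z \<subseteq> (\<lambda>f. Z #> f) ` F"
  proof
    fix R assume "R \<in> rcosets Z"
    then obtain x where x: "x \<in> carrier G" "R = Z #> x" by (auto simp: RCOSETS_def)
    then obtain f where f: "f \<in> F" "x \<in> Z #> f" using F(3) by blast
    then have "Z #> f = Z #> x" using F(2) subgroup_Z by (intro repr_independence) auto
    then show "R \<in> (\<lambda>f. Z #> f) ` F" using x f by auto
  qed
  then show ?thesis using F(1) finite_surj by blast
qed

abbreviation m where "m \<equiv> card (rcosets Z)"

lemma m_pos: "m > 0"
proof -
  have "Z #> \<one> \<in> rcosets Z" using Z_subset by (intro rcosetsI) auto
  then show ?thesis using finite_quotient by (auto simp: card_gt_0_iff)
qed

lemma pow_m_in_Z:
  assumes x: "x \<in> carrier G"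
  shows "x [^] m \<in> Z"
proof -
  interpret Q: group "G Mod Z" by (rule normal.factorgroup_is_group[OF normal_Z])
  have "(Z #> x) [^]\<^bsub>G Mod Z\<^esub> order (G Mod Z) = \<one>\<^bsub>G Mod Z\<^esub>"
    using x by (intro Q.pow_order_eq_1) (auto simp: carrier_FactGroup)
  then have "Z #> (x [^] order (G Mod Z)) = Z"
    using normal.FactGroup_pow[OF normal_Z x] by simp
  moreover have "order (G Mod Z) = m" by (simp add: order_def FactGroup_def)
  ultimately show ?thesis using rcos_self[OF _ subgroup_Z, of "x [^] m"] x by simp
qed

lemma pow_mult_central:
  assumes "x \<in> carrier G" "t \<in> Z"
  shows "(x \<otimes> t) [^] (n::nat) = x [^] n \<otimes> t [^] n"
  using assms Z_subset central by (intro pow_mult_distrib) auto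

text \<open>
  Two such \<open>y\<close> in the same coset of \<open>Z\<close> differ by an \<open>m\<close>-th root of \<open>D\<close> in \<open>Z\<close>, because \<open>Z\<close> is central.
  There are finitely many cosets of \<open>Z\<close>, and by \<open>roots_finite_mod_closed_subgroup\<close> finitely many roots in \<open>Z\<close> modulo \<open>D\<close>.
\<close>

lemma roots_finite_mod:
  assumes D: "subgroup D G" "closedin T D" "D \<subseteq> Z"
  shows "\<exists>F. finite F \<and> F \<subseteq> carrier G \<and> {y \<in> carrier G. y [^] m \<in> D} \<subseteq> (\<Union>f\<in>F. D #> f)"
proof -
  have cl: "closedin (subtopology T Z) D"
    using D(2,3) by (simp add: closedin_closed_subtopology closedin_topgen)
  have "\<exists>F. finite F \<and> F \<subseteq> {t \<in> Z. t [^] m \<in> D} \<and> {t \<in> Z. t [^] m \<in> D} \<subseteq> (\<Union>f\<in>F. D #> f)"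
    using Z.roots_finite_mod_closed_subgroup[OF subgroup_incl[OF D(1) subgroup_Z D(3)] cl m_pos]
    unfolding pow_GZ r_coset_GZ carrier_GZ .
  then obtain F where F0: "finite F" "F \<subseteq> {t \<in> Z. t [^] m \<in> D}"
    and cover: "{t \<in> Z. t [^] m \<in> D} \<subseteq> (\<Union>f\<in>F. D #> f)"
    by (elim exE conjE)
  have F: "finite F" "F \<subseteq> Z" using F0 by auto
  \<comment> \<open>A chosen \<open>m\<close>-th root of \<open>D\<close> in the coset \<open>R\<close>, meaningful only when there is one.\<close>
  define c where "c R = (SOME y. y \<in> R \<and> y [^] m \<in> D)" for R
  have c: "c R \<in> R \<and> c R [^] m \<in> D" if "\<exists>y\<in>R. y [^] m \<in> D" for R
    using someI_ex[of "\<lambda>y. y \<in> R \<and> y [^] m \<in> D"] that unfolding c_def by blast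
  define F' where "F' = (\<lambda>(f, R). f \<otimes> c R) ` (F \<times> {R \<in> rcosets Z. \<exists>y\<in>R. y [^] m \<in> D})"
  have "{y \<in> carrier G. y [^] m \<in> D} \<subseteq> (\<Union>f\<in>F'. D #> f)"
  proof
    fix y assume "y \<in> {y \<in> carrier G. y [^] m \<in> D}"
    then have y: "y \<in> carrier G" "y [^] m \<in> D" by auto
    define R where "R = Z #> y"
    have R: "R \<in> rcosets Z" "y \<in> R"
      using y(1) rcos_self[OF _ subgroup_Z] Z_subset by (auto simp: R_def intro: rcosetsI)
    then have cR: "c R \<in> R" "c R [^] m \<in> D" using c[of R] y(2) by auto
    then obtain t where t: "t \<in> Z" "c R = t \<otimes> y" by (auto simp: R_def r_coset_def)
    have tG: "t \<in> carrier G" using t(1) Z_subset by blast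
    have it: "inv t \<in> Z" by (rule subgroup.m_inv_closed[OF subgroup_Z t(1)])
    have yt: "y = inv t \<otimes> c R" using t tG y(1) by (simp add: m_assoc[symmetric])
    have cG: "c R \<in> carrier G" using t tG y(1) by simp
    have "(inv t) [^] m = y [^] m \<otimes> inv (c R [^] m)"
    proof -
      have "y = c R \<otimes> inv t" using yt central[OF cG it] by simp
      then have "y [^] m = c R [^] m \<otimes> inv t [^] m" using pow_mult_central[OF cG it] by simp
      also have "\<dots> = inv t [^] m \<otimes> c R [^] m"
        using cG tG subgroup.subset[OF D(1)] central[of "inv t [^] m" "c R [^] m"] D(3) cR(2) by auto
      finally show ?thesis using cG tG by (simp add: m_assoc)
    qed
    also have "\<dots> \<in> D" using y(2) cR(2) D(1) by (simp add: subgroup.m_closed subgroup.m_inv_closed)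
    finally obtain f where f: "f \<in> F" "inv t \<in> D #> f" using cover it by blast
    then obtain q where q: "q \<in> D" "inv t = q \<otimes> f" by (auto simp: r_coset_def)
    have "q \<in> carrier G" "f \<in> carrier G" using q(1) f(1) F(2) D(3) Z_subset by auto
    then have "y = q \<otimes> (f \<otimes> c R)"
      using yt q(2) cG by (simp add: m_assoc)
    moreover have "f \<otimes> c R \<in> F'" using f(1) R y(2) by (force simp: F'_def)
    ultimately show "y \<in> (\<Union>f\<in>F'. D #> f)" using q(1) by (auto simp: r_coset_def)
  qed
  moreover have "F' \<subseteq> carrier G"
  proof -
    have "c R \<in> carrier G" if "R \<in> rcosets Z" "\<exists>y\<in>R. y [^] m \<in> D" for R
      using c[OF that(2)] subgroup.rcosets_carrier[OF subgroup_Z group_axioms that(1)] by blast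
    then show ?thesis using F(2) Z_subset by (auto simp: F'_def)
  qed
  moreover have "finite F'" using F(1) finite_quotient by (simp add: F'_def)
  ultimately show ?thesis by blast
qed

abbreviation P where "P \<equiv> coprime_part GZ m"

lemma P_subset: "P \<subseteq> Z" using subgroup.subset[OF Z.subgroup_coprime_part[of m]] by simp

text \<open>
  Send such a subgroup to its intersection \<open>D\<close> with \<open>Z\<close>, one of countably many closed subgroups. Its
  generator \<open>y\<close> satisfies \<open>y\<^sup>m \<in> D\<close>, and the subgroup can be recovered from \<open>D\<close> and the coset of \<open>D\<close> that contains
  \<open>y\<close>; there are finitely many candidates for this coset.
\<close>

lemma countable_topgens_over_coprime_part:
  "countable {topgen G T y |y. y \<in> carrier G \<and> P \<subseteq> topgen G T y}"
proof -
  let ?\<D> = "{D. subgroup D GZ \<and> closedin (subtopology T Z) D \<and> P \<subseteq> D}"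
  let ?\<Phi> = "\<lambda>D y. Abstract_Topology.closure_of T (generate G (insert y D))"
  let ?B = "\<lambda>D. ?\<Phi> D ` {y \<in> carrier G. y [^] m \<in> D}"
  have "countable (?B D)" if "D \<in> ?\<D>" for D
  proof -
    have sub: "subgroup D GZ" using that by simp
    have D: "subgroup D G" "D \<subseteq> Z"
      using incl_subgroup[OF subgroup_Z sub] subgroup.subset[OF sub] by simp_all
    have "closedin T D" using that closedin_closed_subtopology[OF closedin_topgen] by simp
    then obtain F where F: "finite F" "F \<subseteq> carrier G" "{y \<in> carrier G. y [^] m \<in> D} \<subseteq> (\<Union>f\<in>F. D #> f)"
      using roots_finite_mod[OF D(1) _ D(2)] by blast
    have "?B D \<subseteq> ?\<Phi> D ` F"
    proof
      fix C assume "C \<in> ?B D"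
      then obtain y where y: "y \<in> carrier G" "y [^] m \<in> D" "C = ?\<Phi> D y" by auto
      then obtain f where f: "f \<in> F" "y \<in> D #> f" using F(3) by blast
      then have "C = ?\<Phi> D f" using y(3) generate_insert_r_coset[OF D(1) _ f(2)] F(2) by auto
      then show "C \<in> ?\<Phi> D ` F" using f(1) by blast
    qed
    then show ?thesis using F(1) by (meson countable_finite finite_subset finite_imageI)
  qed
  then have "countable (\<Union>D\<in>?\<D>. ?B D)"
    using Z.countable_closed_subgroups_over_coprime_part[OF m_pos] by (intro countable_UN) auto
  moreover have "{topgen G T y |y. y \<in> carrier G \<and> P \<subseteq> topgen G T y} \<subseteq> (\<Union>D\<in>?\<D>. ?B D)"
  proof
    fix C assume "C \<in> {topgen G T y |y. y \<in> carrier G \<and> P \<subseteq> topgen G T y}"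
    then obtain y where y: "y \<in> carrier G" "P \<subseteq> topgen G T y" "C = topgen G T y" by blast
    define D where "D = topgen G T y \<inter> Z"
    have sub: "subgroup (topgen G T y) G" by (rule subgroup_topgen[OF y(1)])
    have "subgroup D G" unfolding D_def by (rule subgroups_Inter_pair[OF sub subgroup_Z])
    then have "subgroup D GZ" using subgroup_incl[OF _ subgroup_Z] by (simp add: D_def)
    moreover have "closedin (subtopology T Z) D"
      by (simp add: D_def closedin_closed_subtopology closedin_topgen closedin_Int)
    moreover have "P \<subseteq> D" using y(2) P_subset by (simp add: D_def)
    ultimately have "D \<in> ?\<D>" by simp
    moreover have "y [^] m \<in> D"
      using pow_m_in_Z[OF y(1)] nat_pow_closed_subgroup[OF sub topgen_self[OF y(1)]]
      by (simp add: D_def)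
    moreover have "C = ?\<Phi> D y" unfolding y(3) by (rule topgen_eq_closure_insert[OF y(1)]) (simp add: D_def)
    ultimately show "C \<in> (\<Union>D\<in>?\<D>. ?B D)" using y(1) by blast
  qed
  ultimately show ?thesis by (rule countable_subset[rotated])
qed

text \<open>
  Choose \<open>s \<in> P\<close> such that \<open>x\<^sup>m s\<close> generates a group containing \<open>P\<close>, and \<open>t \<in> P\<close> with \<open>t\<^sup>m = s\<close>. Then \<open>y = x t\<close>
  has \<open>m\<close>-th power \<open>x\<^sup>m s\<close>, so the closure of the group it generates contains \<open>P\<close>, in particular \<open>t\<close>, and
  hence \<open>x = y t\<inverse>\<close>.
\<close>

lemma in_topgen_over_coprime_part:
  assumes x: "x \<in> carrier G"
  shows "\<exists>y\<in>carrier G. P \<subseteq> topgen G T y \<and> x \<in> topgen G T y"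
proof -
  let ?w = "x [^] m"
  have w: "?w \<in> Z" by (rule pow_m_in_Z[OF x])
  obtain s where s: "s \<in> P" "P \<subseteq> topgen GZ (subtopology T Z) (?w \<otimes> s)"
    using Z.translate_generating_coprime_part[of ?w m] w by auto
  obtain t where t: "t \<in> P" "t [^] m = s"
    using Z.coprime_part_divisible[OF s(1)] unfolding pow_GZ by blast
  have tZ: "t \<in> Z" and sZ: "s \<in> Z" using t(1) s(1) P_subset by auto
  have tG: "t \<in> carrier G" using tZ Z_subset by blast
  define y where "y = x \<otimes> t"
  have y: "y \<in> carrier G" using x tG by (simp add: y_def)
  have sub: "subgroup (topgen G T y) G" by (rule subgroup_topgen[OF y])
  have "y [^] m = ?w \<otimes> s" unfolding y_def using pow_mult_central[OF x tZ] t(2) by simp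
  then have "?w \<otimes> s \<in> topgen G T y"
    using nat_pow_closed_subgroup[OF sub topgen_self[OF y], of m] by simp
  then have "topgen G T (?w \<otimes> s) \<subseteq> topgen G T y" by (rule topgen_subset[OF sub closedin_topgen])
  moreover have "topgen GZ (subtopology T Z) (?w \<otimes> s) = topgen G T (?w \<otimes> s)"
    by (rule topgen_consistent[OF subgroup_Z closedin_topgen subgroup.m_closed[OF subgroup_Z w sZ]])
  ultimately have P: "P \<subseteq> topgen G T y" using s(2) by simp
  then have "inv t \<in> topgen G T y" using t(1) subgroup.m_inv_closed[OF sub] by blast
  then have "y \<otimes> inv t \<in> topgen G T y" by (rule subgroup.m_closed[OF sub topgen_self[OF y]])
  moreover have "y \<otimes> inv t = x" using x tG by (simp add: y_def m_assoc)
  ultimately show ?thesis using P y by auto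
qed

theorem countable_procyclic_cover:
  "\<exists>\<C>. countable \<C> \<and> (\<forall>H\<in>\<C>. procyclic_subgroup H G T) \<and> carrier G = \<Union>\<C>"
proof (intro exI conjI)
  let ?\<C> = "{topgen G T y |y. y \<in> carrier G \<and> P \<subseteq> topgen G T y}"
  show "countable ?\<C>" by (rule countable_topgens_over_coprime_part)
  show "\<forall>H\<in>?\<C>. procyclic_subgroup H G T" using procyclic_subgroup_iff by blast
  show "carrier G = \<Union>?\<C>"
  proof
    show "carrier G \<subseteq> \<Union>?\<C>" using in_topgen_over_coprime_part by blast
    show "\<Union>?\<C> \<subseteq> carrier G" using subgroup.subset[OF subgroup_topgen] by blast
  qed
qed

end

section \<open>Quotients of profinite groups\<close>

lemma procyclic_transport:
  assumes K: "group K" and proL: "procyclic L S" and iso: "\<phi> \<in> iso K L"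
    and homeo: "homeomorphic_map X S \<phi>" and ts: "topspace X = carrier K"
  shows "procyclic K X"
proof -
  interpret L: profinite_group L S using proL by (simp add: procyclic_def)
  interpret hom: group_hom K L \<phi>
    using K L.group_axioms iso by (simp add: group_hom_def group_hom_axioms_def iso_def)
  obtain \<psi> where maps: "homeomorphic_maps X S \<phi> \<psi>" using homeo homeomorphic_map_maps by blast
  have inv: "\<psi> (\<phi> x) = x" if "x \<in> carrier K" for x
    using maps that by (auto simp: homeomorphic_maps_def ts)
  have cont: "continuous_map X S \<phi>" "continuous_map S X \<psi>" using maps by (auto simp: homeomorphic_maps_def)
  have inj: "inj_on \<phi> (carrier K)" using iso by (simp add: iso_def bij_betw_def)
  have pro: "profinite_group K X"
  proof unfold_locales
    show "topspace X = carrier K" by (rule ts)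
    have "continuous_map (prod_topology X X) X (\<lambda>p. \<psi> (\<phi> (fst p) \<otimes>\<^bsub>L\<^esub> \<phi> (snd p)))"
      by (intro continuous_map_compose[OF _ cont(2), unfolded o_def] L.continuous_map_mult
          continuous_map_compose[OF _ cont(1), unfolded o_def] continuous_map_fst continuous_map_snd)
    then show "continuous_map (prod_topology X X) X (\<lambda>(x, y). x \<otimes>\<^bsub>K\<^esub> y)"
    proof (rule continuous_map_eq)
      fix p assume "p \<in> topspace (prod_topology X X)"
      then have p: "fst p \<in> carrier K" "snd p \<in> carrier K" by (auto simp: ts)
      then have "\<phi> (fst p) \<otimes>\<^bsub>L\<^esub> \<phi> (snd p) = \<phi> (fst p \<otimes>\<^bsub>K\<^esub> snd p)" by simp
      moreover have "\<psi> (\<phi> (fst p \<otimes>\<^bsub>K\<^esub> snd p)) = fst p \<otimes>\<^bsub>K\<^esub> snd p"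
        using p by (intro inv) simp
      ultimately show "\<psi> (\<phi> (fst p) \<otimes>\<^bsub>L\<^esub> \<phi> (snd p)) = (case p of (x, y) \<Rightarrow> x \<otimes>\<^bsub>K\<^esub> y)"
        by (simp only: case_prod_beta)
    qed
    have "continuous_map X X (\<lambda>x. \<psi> (inv\<^bsub>L\<^esub> \<phi> x))"
      by (intro continuous_map_compose[OF _ cont(2), unfolded o_def] L.continuous_map_inv cont(1))
    then show "continuous_map X X (\<lambda>x. inv\<^bsub>K\<^esub> x)"
      by (rule continuous_map_eq) (simp add: ts inv flip: hom.hom_inv)
    have "X homeomorphic_space S" using homeo homeomorphic_map_imp_homeomorphic_space by blast
    then show "compact_space X" "Hausdorff_space X"
      using homeomorphic_compact_space homeomorphic_Hausdorff_space L.compact L.Hausdorff by blast+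
    show "totally_disconnected_space X"
      unfolding totally_disconnected_space_def
    proof (intro allI impI)
      fix A assume A: "connectedin X A"
      then have "connectedin S (\<phi> ` A)" using cont(1) connectedin_continuous_map_image by blast
      then obtain a where a: "\<phi> ` A \<subseteq> {a}"
        using L.totally_disconnected unfolding totally_disconnected_space_def by blast
      have "A \<subseteq> carrier K" using connectedin_subset_topspace[OF A] by (simp add: ts)
      then have "x = y" if "x \<in> A" "y \<in> A" for x y
        using inj_onD[OF inj, of x y] a that by blast
      then show "\<exists>a. A \<subseteq> {a}" by blast
    qed
  qed
  obtain l where l: "l \<in> carrier L" "Abstract_Topology.closure_of S (generate L {l}) = carrier L"
    using proL by (auto simp: procyclic_def)
  obtain k where k: "k \<in> carrier K" "l = \<phi> k" using l(1) iso by (auto simp: iso_def bij_betw_def)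
  let ?A = "Abstract_Topology.closure_of X (generate K {k})"
  have gen: "generate K {k} \<subseteq> topspace X" using k(1) ts hom.G.generate_incl[of "{k}"] by simp
  have "generate L {l} = \<phi> ` generate K {k}" using hom.generate_img[of "{k}"] k by simp
  then have "\<phi> ` ?A = carrier L"
    using homeomorphic_map_closure_of[OF homeo gen] l(2) by simp
  also have "carrier L = \<phi> ` carrier K" using iso by (simp add: iso_def bij_betw_def)
  finally have "?A = carrier K"
    using inj_on_image_eq_iff[OF inj] closure_of_subset_topspace[of X] ts by (metis subset_refl)
  then show ?thesis using pro k(1) by (auto simp: procyclic_def)
qed

context profinite_group
begin

text \<open>
  The first isomorphism theorem for compact groups: the induced map is a continuous bijection from a
  compact space to a Hausdorff space, hence a homeomorphism, along which all the structure is transported.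
\<close>

lemma procyclic_quotient_by_kernel:
  assumes hom: "V \<in> hom G L" and cont: "continuous_map T S V" and surj: "V ` carrier G = carrier L"
    and proL: "procyclic L S"
  shows "procyclic (G Mod kernel G L V) (quotient_topology T (\<lambda>x. kernel G L V #> x))"
proof -
  interpret L: profinite_group L S using proL by (simp add: procyclic_def)
  interpret V: group_hom G L V
    using group_axioms L.group_axioms hom by (simp add: group_hom_def group_hom_axioms_def)
  let ?N = "kernel G L V"
  let ?Q = "quotient_topology T (\<lambda>x. ?N #> x)"
  let ?\<phi> = "\<lambda>X. the_elem (V ` X)"
  have ts: "topspace ?Q = carrier (G Mod ?N)"
    by (simp add: topspace_quotient_topology carrier_FactGroup topspace_eq)
  have \<phi>: "?\<phi> (?N #> x) = V x" if x: "x \<in> carrier G" for x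
  proof -
    have "V ` (?N #> x) = {V x}"
    proof
      show "V ` (?N #> x) \<subseteq> {V x}" using x by (auto simp: r_coset_def kernel_def)
      show "{V x} \<subseteq> V ` (?N #> x)" using rcos_self[OF x V.subgroup_kernel] by blast
    qed
    then show ?thesis by simp
  qed
  have iso: "?\<phi> \<in> iso (G Mod ?N) L" by (rule V.FactGroup_iso_set[OF surj])
  have "continuous_map T S (?\<phi> \<circ> (\<lambda>x. ?N #> x))"
    using cont by (rule continuous_map_eq) (simp add: \<phi> topspace_eq)
  then have c\<phi>: "continuous_map ?Q S ?\<phi>"
    by (rule continuous_compose_quotient_map[OF quotient_map_quotient_topology])
  have "homeomorphic_map ?Q S ?\<phi>"
  proof (rule continuous_imp_homeomorphic_map[OF c\<phi> _ L.Hausdorff])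
    have "compactin ?Q ((\<lambda>x. ?N #> x) ` topspace T)"
      using compact unfolding compact_space_def
      by (rule image_compactin[OF _ quotient_imp_continuous_map[OF quotient_map_quotient_topology]])
    then show "compact_space ?Q" by (simp add: compact_space_def topspace_quotient_topology)
    show "?\<phi> ` topspace ?Q = topspace S" "inj_on ?\<phi> (topspace ?Q)"
      using iso by (simp_all add: iso_def bij_betw_def ts L.topspace_eq)
  qed
  then show ?thesis
    using procyclic_transport[OF normal.factorgroup_is_group[OF V.normal_kernel] proL iso _ ts] by blast
qed

end

section \<open>The transfer to a central subgroup of finite index\<close>

context central_procyclic
begin

definition rep where "rep R = (SOME x. x \<in> R)"

text \<open>
  The factor in \<open>rep R g = cocycle R g rep (R g)\<close>; it lies in \<open>Z\<close>.
\<close>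

definition cocycle where "cocycle R g = rep R \<otimes> g \<otimes> inv (rep (R #> g))"

text \<open>
  The group-theoretic transfer from \<open>G\<close> to \<open>Z\<close>, built from the right cosets of \<open>Z\<close>.
\<close>

definition transfer where "transfer g = finprod GZ (\<lambda>R. cocycle R g) (rcosets Z)"

lemma rcoset_translate:
  assumes "R \<in> rcosets Z" "g \<in> carrier G"
  shows "R #> g \<in> rcosets Z"
proof -
  obtain x where x: "x \<in> carrier G" "R = Z #> x" using assms(1) by (auto simp: RCOSETS_def)
  then have "R #> g = Z #> (x \<otimes> g)" using assms(2) Z_subset by (simp add: coset_mult_assoc)
  then show ?thesis using x(1) assms(2) Z_subset by (auto intro: rcosetsI)
qed

lemma rcoset_translate_mult:
  assumes "R \<in> rcosets Z" "g \<in> carrier G" "h \<in> carrier G"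
  shows "R #> g #> h = R #> (g \<otimes> h)"
  using assms subgroup.rcosets_carrier[OF subgroup_Z group_axioms] by (simp add: coset_mult_assoc)

lemma rep_in: "R \<in> rcosets Z \<Longrightarrow> rep R \<in> R"
  unfolding rep_def using subgroup.rcosets_non_empty[OF subgroup_Z] by (simp add: some_in_eq)

lemma rep_carrier: "R \<in> rcosets Z \<Longrightarrow> rep R \<in> carrier G"
  using rep_in subgroup.rcosets_carrier[OF subgroup_Z group_axioms] by blast

lemma rcoset_diff_in_Z:
  assumes "R \<in> rcosets Z" "x \<in> R" "y \<in> R"
  shows "x \<otimes> inv y \<in> Z"
proof -
  obtain a where a: "a \<in> carrier G" "R = Z #> a" using assms(1) by (auto simp: RCOSETS_def)
  obtain s t where st: "s \<in> Z" "t \<in> Z" "x = s \<otimes> a" "y = t \<otimes> a"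
    using assms(2,3) a(2) by (auto simp: r_coset_def)
  have "s \<in> carrier G" "t \<in> carrier G" using st Z_subset by auto
  then have "x \<otimes> inv y = s \<otimes> inv t"
    using st(3,4) a(1) by (simp add: inv_mult_group m_assoc) (simp add: m_assoc[symmetric])
  then show ?thesis
    using subgroup.m_closed[OF subgroup_Z st(1) subgroup.m_inv_closed[OF subgroup_Z st(2)]] by simp
qed

text \<open>
  The elements \<open>rep R g\<close> and \<open>rep (R g)\<close> represent the same coset of \<open>Z\<close>.
\<close>

lemma cocycle_in_Z:
  assumes "R \<in> rcosets Z" "g \<in> carrier G"
  shows "cocycle R g \<in> Z"
  unfolding cocycle_def
proof (rule rcoset_diff_in_Z[OF rcoset_translate[OF assms] _ rep_in[OF rcoset_translate[OF assms]]])
  show "rep R \<otimes> g \<in> R #> g" using rep_in[OF assms(1)] by (auto simp: r_coset_def)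
qed

lemma cocycle_mult:
  assumes R: "R \<in> rcosets Z" and gh: "g \<in> carrier G" "h \<in> carrier G"
  shows "cocycle R (g \<otimes> h) = cocycle R g \<otimes> cocycle (R #> g) h"
proof -
  have Rg: "R #> g \<in> rcosets Z" and Rgh: "R #> (g \<otimes> h) \<in> rcosets Z"
    using rcoset_translate R gh by auto
  have "cocycle R g \<otimes> cocycle (R #> g) h
      = rep R \<otimes> g \<otimes> inv (rep (R #> g)) \<otimes> (rep (R #> g) \<otimes> h \<otimes> inv (rep (R #> (g \<otimes> h))))"
    by (simp add: cocycle_def rcoset_translate_mult[OF R gh])
  also have "\<dots> = cocycle R (g \<otimes> h)"
  proof -
    have "inv (rep (R #> g)) \<otimes> (rep (R #> g) \<otimes> y) = y" if "y \<in> carrier G" for y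
      using that rep_carrier[OF Rg] by (simp add: m_assoc[symmetric])
    then show ?thesis
      using rep_carrier[OF R] rep_carrier[OF Rg] rep_carrier[OF Rgh] gh by (simp add: cocycle_def m_assoc)
  qed
  finally show ?thesis by simp
qed

lemma transfer_in_Z: "g \<in> carrier G \<Longrightarrow> transfer g \<in> Z"
  using Z.finprod_closed[of "\<lambda>R. cocycle R g" "rcosets Z"] cocycle_in_Z
  by (simp add: transfer_def Pi_iff)

text \<open>
  The cocycle identity splits the product for \<open>g h\<close> in two. In the second factor the cosets are permuted by
  right multiplication with \<open>g\<close>, which does not change the product.
\<close>

lemma transfer_mult:
  assumes gh: "g \<in> carrier G" "h \<in> carrier G"
  shows "transfer (g \<otimes> h) = transfer g \<otimes> transfer h"
proof -
  have bij: "inj_on (\<lambda>R. R #> g) (rcosets Z)" "(\<lambda>R. R #> g) ` (rcosets Z) = rcosets Z"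
  proof -
    have translate_back: "R #> g #> inv g = R" "R #> inv g #> g = R" if "R \<in> rcosets Z" for R
      using that gh(1) subgroup.rcosets_carrier[OF subgroup_Z group_axioms that]
      by (simp_all add: rcoset_translate_mult coset_mult_one)
    show "inj_on (\<lambda>R. R #> g) (rcosets Z)" by (rule inj_on_inverseI[where g = "\<lambda>R. R #> inv g"]) (rule translate_back)
    show "(\<lambda>R. R #> g) ` (rcosets Z) = rcosets Z"
    proof
      show "(\<lambda>R. R #> g) ` (rcosets Z) \<subseteq> rcosets Z" using rcoset_translate gh(1) by blast
      show "rcosets Z \<subseteq> (\<lambda>R. R #> g) ` (rcosets Z)"
        using translate_back(2) rcoset_translate[of _ "inv g"] gh(1) by (metis image_eqI inv_closed subsetI)
    qed
  qed
  have "transfer (g \<otimes> h) = finprod GZ (\<lambda>R. cocycle R g \<otimes>\<^bsub>GZ\<^esub> cocycle (R #> g) h) (rcosets Z)"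
    unfolding transfer_def
    using cocycle_in_Z rcoset_translate gh cocycle_mult subgroup.m_closed[OF subgroup_Z]
    by (intro Z.finprod_cong') (auto simp: Pi_iff)
  also have "\<dots> = transfer g \<otimes>\<^bsub>GZ\<^esub> finprod GZ (\<lambda>R. cocycle (R #> g) h) (rcosets Z)"
    unfolding transfer_def
    using cocycle_in_Z rcoset_translate gh by (intro Z.finprod_multf) (auto simp: Pi_iff)
  also have "finprod GZ (\<lambda>R. cocycle (R #> g) h) (rcosets Z) = transfer h"
    using Z.finprod_reindex[of "\<lambda>R. cocycle R h" "\<lambda>R. R #> g" "rcosets Z"] bij cocycle_in_Z gh
    by (simp add: transfer_def Pi_iff)
  finally show ?thesis by simp
qed

lemma transfer_on_Z:
  assumes t: "t \<in> Z"
  shows "transfer t = t [^] m"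
proof -
  have tG: "t \<in> carrier G" using t Z_subset by blast
  have "cocycle R t = t" if R: "R \<in> rcosets Z" for R
  proof -
    obtain x where x: "x \<in> carrier G" "R = Z #> x" using R by (auto simp: RCOSETS_def)
    have "R #> t = Z #> (x \<otimes> t)" using x tG Z_subset by (simp add: coset_mult_assoc)
    also have "\<dots> = Z #> (t \<otimes> x)" using central[OF x(1) t] by simp
    also have "\<dots> = Z #> t #> x" using x tG Z_subset by (simp add: coset_mult_assoc)
    also have "\<dots> = R" using coset_join2[OF tG subgroup_Z t] x(2) by simp
    finally have "cocycle R t = rep R \<otimes> t \<otimes> inv (rep R)" by (simp add: cocycle_def)
    also have "\<dots> = t" using central[OF rep_carrier[OF R] t] rep_carrier[OF R] tG by (simp add: m_assoc)
    finally show ?thesis .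
  qed
  then have "transfer t = finprod GZ (\<lambda>R. t) (rcosets Z)"
    unfolding transfer_def using t by (intro Z.finprod_cong') auto
  also have "\<dots> = t [^]\<^bsub>GZ\<^esub> m" using t by (intro Z.finprod_const) simp
  finally show ?thesis by (simp add: pow_GZ)
qed

text \<open>
  On the open coset of \<open>Z\<close> containing \<open>f\<close> the transfer is the continuous map \<open>t f \<mapsto> t\<^sup>m transfer f\<close>.
\<close>

lemma continuous_transfer: "continuous_map T T transfer"
  unfolding continuous_map_def
proof (intro conjI allI impI)
  show "transfer \<in> topspace T \<rightarrow> topspace T" using transfer_in_Z Z_subset by (auto simp: topspace_eq)
  fix W assume W: "openin T W"
  let ?U = "\<lambda>f. Z \<inter> {t \<in> topspace T. t [^] m \<otimes> transfer f \<in> W}"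
  have U: "openin T (?U f)" if "f \<in> carrier G" for f
    using that transfer_in_Z Z_subset
    by (intro openin_Int open_topgen openin_continuous_map_preimage[OF continuous_map_mult W] continuous_map_pow)
      (auto simp: topspace_eq)
  have "{g \<in> topspace T. transfer g \<in> W} = (\<Union>f\<in>carrier G. ?U f #> f)"
  proof
    show "{g \<in> topspace T. transfer g \<in> W} \<subseteq> (\<Union>f\<in>carrier G. ?U f #> f)"
    proof
      fix g assume "g \<in> {g \<in> topspace T. transfer g \<in> W}"
      then have g: "g \<in> carrier G" "transfer g \<in> W" by (auto simp: topspace_eq)
      have "transfer g \<in> carrier G" using transfer_in_Z g(1) Z_subset by blast
      then have "\<one> \<in> ?U g" using g subgroup.one_closed[OF subgroup_Z] by (simp add: topspace_eq)
      then have "\<one> \<otimes> g \<in> ?U g #> g" unfolding r_coset_def by blast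
      then show "g \<in> (\<Union>f\<in>carrier G. ?U f #> f)" using g(1) by auto
    qed
    show "(\<Union>f\<in>carrier G. ?U f #> f) \<subseteq> {g \<in> topspace T. transfer g \<in> W}"
    proof
      fix g assume "g \<in> (\<Union>f\<in>carrier G. ?U f #> f)"
      then obtain f t where ft: "f \<in> carrier G" "t \<in> ?U f" "g = t \<otimes> f" by (auto simp: r_coset_def)
      then have "t \<in> carrier G" by (simp add: topspace_eq)
      then show "g \<in> {g \<in> topspace T. transfer g \<in> W}"
        using ft transfer_mult[of t f] transfer_on_Z[of t] by (simp add: topspace_eq)
    qed
  qed
  moreover have "openin T (\<Union>f\<in>carrier G. ?U f #> f)"
    using U by (intro openin_Union) (auto intro!: openin_r_coset)
  ultimately show "openin T {g \<in> topspace T. transfer g \<in> W}" by simp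
qed

text \<open>
  The kernel meets \<open>Z\<close> in its \<open>m\<close>-torsion, which is finite, and each of the finitely many other cosets of
  \<open>Z\<close> in at most a translate of this set.
\<close>

lemma finite_kernel_transfer: "finite {g \<in> carrier G. transfer g = \<one>}" (is "finite ?N")
proof -
  have "closedin T {\<one>}" using Hausdorff by (simp add: closedin_Hausdorff_sing_eq topspace_eq)
  then obtain F where F: "finite F" "F \<subseteq> carrier G" "{y \<in> carrier G. y [^] m \<in> {\<one>}} \<subseteq> (\<Union>f\<in>F. {\<one>} #> f)"
    using roots_finite_mod[OF triv_subgroup] subgroup.one_closed[OF subgroup_Z] by auto
  have "?N \<inter> Z \<subseteq> F"
  proof
    fix t assume t: "t \<in> ?N \<inter> Z"
    then have "t \<in> (\<Union>f\<in>F. {\<one>} #> f)" using F(3) transfer_on_Z[of t] by auto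
    then show "t \<in> F" using F(2) by (auto simp: r_coset_def)
  qed
  then have fin: "finite (?N \<inter> Z)" using F(1) finite_subset by blast
  have "finite (?N \<inter> R)" if R: "R \<in> rcosets Z" for R
  proof (cases "?N \<inter> R = {}")
    case False
    then obtain a where a: "a \<in> carrier G" "transfer a = \<one>" "a \<in> R" by blast
    have "?N \<inter> R \<subseteq> (\<lambda>t. t \<otimes> a) ` (?N \<inter> Z)"
    proof
      fix b assume b: "b \<in> ?N \<inter> R"
      have c: "b \<otimes> inv a \<in> Z" using rcoset_diff_in_Z[OF R] a b by blast
      have eq: "b = b \<otimes> inv a \<otimes> a" using a b by (simp add: m_assoc)
      have "transfer (b \<otimes> inv a) \<in> carrier G" using transfer_in_Z[of "b \<otimes> inv a"] a b Z_subset by auto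
      moreover have "\<one> = transfer (b \<otimes> inv a) \<otimes> \<one>"
        using transfer_mult[of "b \<otimes> inv a" a] a b eq by simp
      ultimately have "transfer (b \<otimes> inv a) = \<one>" by simp
      then show "b \<in> (\<lambda>t. t \<otimes> a) ` (?N \<inter> Z)" using c eq a b by (intro image_eqI[of _ _ "b \<otimes> inv a"]) auto
    qed
    then show ?thesis using fin finite_surj by blast
  qed simp
  moreover have "?N \<subseteq> (\<Union>R\<in>rcosets Z. ?N \<inter> R)" using rcosets_part_G[OF subgroup_Z] by blast
  ultimately show ?thesis using finite_quotient by (meson finite_UN_I finite_subset)
qed

theorem finite_by_procyclic: "finite_by_procyclic G T"
proof -
  let ?L = "transfer ` carrier G"
  have LZ: "?L \<subseteq> Z" using transfer_in_Z by blast
  have hom: "transfer \<in> hom G G" using transfer_mult transfer_in_Z Z_subset by (auto simp: hom_def)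
  interpret tr: group_hom G G transfer using hom by unfold_locales
  have L: "subgroup ?L G" by (rule tr.img_is_subgroup)
  have "compactin T (transfer ` topspace T)"
    using compact unfolding compact_space_def by (rule image_compactin[OF _ continuous_transfer])
  then have "closedin T ?L" using compactin_imp_closedin[OF Hausdorff] by (simp add: topspace_eq)
  then have "\<exists>r\<in>?L. ?L = topgen G T r" using closed_subgroup_of_topgen[OF L _ z_carrier LZ] by blast
  then have "procyclic_subgroup ?L G T"
    using procyclic_subgroup_iff subgroup.subset[OF L] by blast
  then have pro: "procyclic (G\<lparr>carrier := ?L\<rparr>) (subtopology T ?L)" by (simp add: procyclic_subgroup_def)
  let ?N = "kernel G (G\<lparr>carrier := ?L\<rparr>) transfer"
  have "transfer \<in> hom G (G\<lparr>carrier := ?L\<rparr>)" using transfer_mult by (auto simp: hom_def)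
  moreover have "continuous_map T (subtopology T ?L) transfer"
    using continuous_transfer by (simp add: continuous_map_in_subtopology topspace_eq)
  ultimately have "procyclic (G Mod ?N) (quotient_topology T (\<lambda>x. ?N #> x))"
    by (rule procyclic_quotient_by_kernel[OF _ _ _ pro]) simp
  moreover have N: "?N = kernel G G transfer" by (simp add: kernel_def)
  moreover have "finite ?N" using finite_kernel_transfer by (simp add: kernel_def)
  moreover have "?N \<lhd> G" unfolding N by (rule tr.normal_kernel)
  ultimately show ?thesis
    unfolding finite_by_procyclic_def using profinite_group_axioms by blast
qed

end

section \<open>Finding an open central procyclic subgroup\<close>

context profinite_group
begin

lemma central_procyclicI:
  assumes A: "subgroup A G" "openin T A" and g: "g \<in> carrier G" "A \<subseteq> topgen G T g"
    and central: "\<And>x t. x \<in> carrier G \<Longrightarrow> t \<in> A \<Longrightarrow> x \<otimes> t = t \<otimes> x"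
  shows "\<exists>z. central_procyclic G T z"
proof -
  obtain z where z: "z \<in> A" "A = topgen G T z"
    using closed_subgroup_of_topgen[OF A(1) open_subgroup_closedin[OF A] g] by blast
  then have "z \<in> carrier G" using subgroup.subset[OF A(1)] by blast
  then have "central_procyclic G T z"
    using A(2) central unfolding z(2) by unfold_locales
  then show ?thesis by blast
qed

text \<open>
  A closed subgroup that is not open has empty interior, so by Baire the non-open members of the cover
  cannot cover \<open>W\<close>.
\<close>

lemma open_member_meets:
  assumes \<C>: "countable \<C>" "\<And>C. C \<in> \<C> \<Longrightarrow> subgroup C G" "\<And>C. C \<in> \<C> \<Longrightarrow> closedin T C"
    and cover: "carrier G = \<Union>\<C>" and W: "openin T W" "W \<noteq> {}"
  shows "\<exists>C\<in>\<C>. openin T C \<and> C \<inter> W \<noteq> {}"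
proof (rule ccontr)
  assume no: "\<not> ?thesis"
  let ?\<G> = "{C \<in> \<C>. \<not> openin T C}"
  have WG: "W \<subseteq> carrier G" using openin_subset[OF W(1)] by (simp add: topspace_eq)
  have "Abstract_Topology.interior_of T (\<Union>?\<G>) = {}"
  proof (rule Baire_category_alt)
    show "completely_metrizable_space T \<or> locally_compact_space T \<and> regular_space T"
      using compact_imp_locally_compact_space[OF compact]
        compact_Hausdorff_imp_regular_space[OF compact Hausdorff] by blast
    show "countable ?\<G>" by (rule countable_subset[OF _ \<C>(1)]) blast
    fix C assume C: "C \<in> ?\<G>"
    show "closedin T C \<and> Abstract_Topology.interior_of T C = {}"
      using C \<C> openin_subgroupI[of C "Abstract_Topology.interior_of T C"]
        openin_interior_of[of T C] interior_of_subset[of T C] by blast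
  qed
  moreover have "W \<subseteq> \<Union>?\<G>"
  proof
    fix x assume x: "x \<in> W"
    then obtain C where C: "C \<in> \<C>" "x \<in> C" using WG cover by auto
    then have "\<not> openin T C" using no x by auto
    then show "x \<in> \<Union>?\<G>" using C by auto
  qed
  ultimately have "W \<subseteq> {}" using interior_of_maximal[OF _ W(1)] by metis
  then show False using W(2) by blast
qed

text \<open>
  Every coset of an open member \<open>H\<close> meets an open member \<open>C\<close>. If \<open>v f\<close> lies in \<open>C\<close> with \<open>v \<in> H\<close>, then an element
  of \<open>C \<inter> H\<close> commutes with \<open>v f\<close> and with \<open>v\<close>, hence with \<open>f\<close>.
\<close>

theorem central_procyclic_if_countable_cover:
  assumes \<C>: "countable \<C>" "\<And>C. C \<in> \<C> \<Longrightarrow> procyclic_subgroup C G T" and cover: "carrier G = \<Union>\<C>"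
  shows "\<exists>z. central_procyclic G T z"
proof -
  have sub: "subgroup C G" and cl: "closedin T C" if "C \<in> \<C>" for C
    using \<C>(2)[OF that] by (simp_all add: procyclic_subgroup_def)
  have comm: "x \<otimes> y = y \<otimes> x" if xy: "C \<in> \<C>" "x \<in> C" "y \<in> C" for C x y
  proof -
    obtain g where g: "g \<in> carrier G" "C = topgen G T g"
      using \<C>(2)[OF xy(1)] procyclic_subgroup_iff by blast
    then show ?thesis using topgen_commute[OF g(1), of x y] xy(2,3) by simp
  qed
  note meets = open_member_meets[OF \<C>(1) sub cl cover]
  have "openin T (carrier G)" using openin_topspace[of T] by (simp add: topspace_eq)
  then obtain H where H: "H \<in> \<C>" "openin T H" using meets[of "carrier G"] one_closed by blast
  obtain h where h: "h \<in> carrier G" "H = topgen G T h"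
    using \<C>(2)[OF H(1)] procyclic_subgroup_iff by blast
  have HG: "H \<subseteq> carrier G" by (rule subgroup.subset[OF sub[OF H(1)]])
  obtain F where F: "finite F" "F \<subseteq> carrier G" "carrier G = (\<Union>f\<in>F. H #> f)"
    using open_subgroup_finite_cosets[OF sub[OF H(1)] H(2)] by blast
  have "\<exists>C\<in>\<C>. openin T C \<and> C \<inter> (H #> f) \<noteq> {}" if "f \<in> F" for f
    using that F(2) rcos_self[OF _ sub[OF H(1)], of f]
    by (intro meets openin_r_coset H(2)) auto
  then obtain C where C: "\<And>f. f \<in> F \<Longrightarrow> C f \<in> \<C> \<and> openin T (C f) \<and> C f \<inter> (H #> f) \<noteq> {}"
    by metis
  define A where "A = \<Inter>(insert H (C ` F))"
  have subA: "subgroup A G" unfolding A_def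
    by (rule subgroups_Inter) (use sub H(1) C in auto)
  have openA: "openin T A" unfolding A_def
    by (rule openin_Inter) (use F(1) H(2) C in auto)
  have AH: "A \<subseteq> H" by (auto simp: A_def)
  show ?thesis
  proof (rule central_procyclicI[OF subA openA h(1)])
    show "A \<subseteq> topgen G T h" using AH h(2) by simp
    fix x t assume x: "x \<in> carrier G" and t: "t \<in> A"
    let ?Ct = "{x \<in> carrier G. x \<otimes> t = t \<otimes> x}"
    have tG: "t \<in> carrier G" using t AH HG by blast
    have Ct: "subgroup ?Ct G" by (rule subgroup_centralizer_elem[OF tG])
    have HC: "H \<subseteq> ?Ct" using comm[OF H(1)] t AH HG by blast
    obtain f u where f: "f \<in> F" "u \<in> H" "x = u \<otimes> f" using x F(3) by (auto simp: r_coset_def)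
    obtain v where v: "v \<in> H" "v \<otimes> f \<in> C f" using C[OF f(1)] by (auto simp: r_coset_def)
    have carr: "v \<in> carrier G" "f \<in> carrier G" using v f F(2) HG by auto
    have "t \<in> C f" using t f(1) by (auto simp: A_def)
    then have "v \<otimes> f \<in> ?Ct" using comm[of "C f" "v \<otimes> f" t] C[OF f(1)] v(2) carr by simp
    moreover have "inv v \<in> ?Ct" using HC v(1) subgroup.m_inv_closed[OF sub[OF H(1)]] by blast
    ultimately have "inv v \<otimes> (v \<otimes> f) \<in> ?Ct" using subgroup.m_closed[OF Ct] by blast
    then have "f \<in> ?Ct" using carr by (simp add: m_assoc[symmetric])
    then have "u \<otimes> f \<in> ?Ct" using HC f(2) subgroup.m_closed[OF Ct] by blast
    then show "x \<otimes> t = t \<otimes> x" using f(3) by simp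
  qed
qed

text \<open>
  Conjugation maps \<open>n\<close> into the finite, hence discrete, set \<open>N\<close>, so the condition \<open>x n x\<inverse> = n\<close> amounts to
  avoiding the closed set \<open>N - {n}\<close>.
\<close>

lemma openin_centralizer_of_normal_finite:
  assumes N: "N \<lhd> G" "finite N" and n: "n \<in> N"
  shows "openin T {x \<in> carrier G. x \<otimes> n = n \<otimes> x}"
proof -
  have NG: "N \<subseteq> carrier G" using N(1) by (simp add: normal_imp_subgroup subgroup.subset)
  have nG: "n \<in> carrier G" using n NG by blast
  have "closedin T (N - {n})"
    using N(2) NG Hausdorff by (intro closedin_Hausdorff_finite) (auto simp: topspace_eq)
  then have op: "openin T (topspace T - (N - {n}))" by (rule openin_diff[OF openin_topspace])
  have "continuous_map T T (\<lambda>x. x \<otimes> n \<otimes> inv x)"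
    using nG by (intro continuous_map_mult continuous_inv) (auto simp: topspace_eq)
  from openin_continuous_map_preimage[OF this op]
  have "openin T {x \<in> topspace T. x \<otimes> n \<otimes> inv x \<in> topspace T - (N - {n})}" .
  moreover have iff: "x \<otimes> n \<otimes> inv x \<in> topspace T - (N - {n}) \<longleftrightarrow> x \<otimes> n = n \<otimes> x" if x: "x \<in> carrier G" for x
  proof -
    have "x \<otimes> n \<otimes> inv x \<in> N" using N(1) x n by (simp add: normal_inv_iff)
    moreover have "x \<otimes> n \<otimes> inv x = n \<longleftrightarrow> x \<otimes> n = n \<otimes> x"
      using x nG by (metis inv_solve_right m_closed)
    ultimately show ?thesis using NG by (auto simp: topspace_eq)
  qed
  have "{x \<in> topspace T. x \<otimes> n \<otimes> inv x \<in> topspace T - (N - {n})} = {x \<in> carrier G. x \<otimes> n = n \<otimes> x}"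
    by (rule Collect_cong) (use iff in \<open>auto simp only: topspace_eq\<close>)
  ultimately show ?thesis by simp
qed

text \<open>
  Let \<open>C\<close> be the closure of the group generated by a lift \<open>g\<close> of a generator. The product of \<open>C\<close> and the finite
  group \<open>N\<close> is closed and is the full preimage of the image of \<open>C\<close>. So that image is a closed subgroup
  containing the generator, and it must be the whole quotient.
\<close>

lemma procyclic_quotient_lift:
  assumes N: "N \<lhd> G" "finite N"
    and pro: "procyclic (G Mod N) (quotient_topology T (\<lambda>x. N #> x))"
  shows "\<exists>g\<in>carrier G. carrier G = (\<Union>n\<in>N. topgen G T g #> n)"
proof -
  let ?Q = "quotient_topology T (\<lambda>x. N #> x)" and ?q = "\<lambda>x. N #> x"
  have subN: "subgroup N G" using N(1) by (rule normal_imp_subgroup)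
  have NG: "N \<subseteq> carrier G" by (rule subgroup.subset[OF subN])
  interpret Q: group "G Mod N" by (rule normal.factorgroup_is_group[OF N(1)])
  interpret q: group_hom G "G Mod N" ?q
    using normal.r_coset_hom_Mod[OF N(1)] by unfold_locales
  obtain c where c: "c \<in> carrier (G Mod N)"
      "Abstract_Topology.closure_of ?Q (generate (G Mod N) {c}) = carrier (G Mod N)"
    using pro by (auto simp: procyclic_def)
  then obtain g where g: "g \<in> carrier G" "c = N #> g" by (auto simp: carrier_FactGroup)
  let ?C = "topgen G T g"
  have C: "subgroup ?C G" by (rule subgroup_topgen[OF g(1)])
  have CG: "?C \<subseteq> carrier G" by (rule subgroup.subset[OF C])
  let ?A = "\<Union>n\<in>N. ?C #> n"
  have A: "?A = {x \<in> topspace T. N #> x \<in> ?q ` ?C}"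
  proof
    show "?A \<subseteq> {x \<in> topspace T. N #> x \<in> ?q ` ?C}"
    proof
      fix x assume "x \<in> ?A"
      then obtain n d where nd: "n \<in> N" "d \<in> ?C" "x = d \<otimes> n" by (auto simp: r_coset_def)
      have carr: "n \<in> carrier G" "d \<in> carrier G" using nd NG CG by auto
      have "d \<otimes> n \<otimes> inv d \<in> N" using N(1) nd(1) carr by (simp add: normal_inv_iff)
      moreover have "x = d \<otimes> n \<otimes> inv d \<otimes> d" using nd(3) carr by (simp add: m_assoc)
      ultimately have "x \<in> N #> d" unfolding r_coset_def by blast
      then have "N #> d = N #> x" using carr subN by (intro repr_independence)
      then show "x \<in> {x \<in> topspace T. N #> x \<in> ?q ` ?C}" using nd carr by (auto simp: topspace_eq)
    qed
    show "{x \<in> topspace T. N #> x \<in> ?q ` ?C} \<subseteq> ?A"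
    proof
      fix x assume "x \<in> {x \<in> topspace T. N #> x \<in> ?q ` ?C}"
      then obtain d where d: "x \<in> carrier G" "d \<in> ?C" "N #> x = N #> d" by (auto simp: topspace_eq)
      then have "x \<in> N #> d" using rcos_self[OF _ subN] by blast
      then obtain n where n: "n \<in> N" "x = n \<otimes> d" by (auto simp: r_coset_def)
      have carr: "n \<in> carrier G" "d \<in> carrier G" using n d NG CG by auto
      have "inv d \<otimes> n \<otimes> inv (inv d) \<in> N" using N(1) n(1) carr unfolding normal_inv_iff by blast
      then have "inv d \<otimes> n \<otimes> d \<in> N" using carr by simp
      moreover have "x = d \<otimes> (inv d \<otimes> n \<otimes> d)" using n(2) carr by (simp add: m_assoc[symmetric])
      ultimately show "x \<in> ?A" using d(2) by (auto simp: r_coset_def)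
    qed
  qed
  have "closedin T ?A"
    using N(2) NG by (intro closedin_Union) (auto intro!: closedin_r_coset closedin_topgen)
  then have cl: "closedin T {x \<in> topspace T. N #> x \<in> ?q ` ?C}" by (simp only: A)
  have "?q ` ?C \<subseteq> topspace ?Q"
    unfolding topspace_quotient_topology topspace_eq by (rule image_mono[OF CG])
  then have "closedin ?Q (?q ` ?C)"
    using quotient_map_quotient_topology[of T ?q, unfolded quotient_map_closedin,
        THEN conjunct2, THEN spec, of "?q ` ?C"] cl by (simp only: simp_thms)
  moreover have "generate (G Mod N) {c} \<subseteq> ?q ` ?C"
    using g(2) topgen_self[OF g(1)] by (intro Q.generate_subgroup_incl q.subgroup_img_is_subgroup C) auto
  ultimately have "carrier (G Mod N) \<subseteq> ?q ` ?C"
    unfolding c(2)[symmetric] by (rule_tac closure_of_minimal)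
  then have "carrier G \<subseteq> ?A" unfolding A by (auto simp: carrier_FactGroup topspace_eq)
  moreover have "?A \<subseteq> carrier G" unfolding A by (auto simp: topspace_eq)
  ultimately show ?thesis using g(1) by blast
qed

text \<open>
  In a product \<open>G = C N\<close> with \<open>C\<close> abelian, an element of \<open>C\<close> that centralises \<open>N\<close> is central. These elements
  form an open subgroup because \<open>C\<close> has finite index and the centralisers of the elements of \<open>N\<close> are open.
\<close>

theorem central_procyclic_if_finite_by_procyclic:
  assumes "finite_by_procyclic G T"
  shows "\<exists>z. central_procyclic G T z"
proof -
  obtain N where N: "N \<lhd> G" "finite N"
    and pro: "procyclic (G Mod N) (quotient_topology T (\<lambda>x. N #> x))"
    using assms by (auto simp: finite_by_procyclic_def)
  have subN: "subgroup N G" using N(1) by (rule normal_imp_subgroup)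
  have NG: "N \<subseteq> carrier G" by (rule subgroup.subset[OF subN])
  obtain g where g: "g \<in> carrier G" "carrier G = (\<Union>n\<in>N. topgen G T g #> n)"
    using procyclic_quotient_lift[OF N pro] by blast
  let ?C = "topgen G T g"
  have C: "subgroup ?C G" by (rule subgroup_topgen[OF g(1)])
  have CG: "?C \<subseteq> carrier G" by (rule subgroup.subset[OF C])
  have "openin T ?C"
    using closed_finite_index_openin[OF C closedin_topgen N(2) NG] g(2) by simp
  let ?Cn = "\<lambda>n. {x \<in> carrier G. x \<otimes> n = n \<otimes> x}"
  define A where "A = \<Inter>(insert ?C (?Cn ` N))"
  have subA: "subgroup A G" unfolding A_def
    by (rule subgroups_Inter) (use C subgroup_centralizer_elem NG in auto)
  have openA: "openin T A" unfolding A_def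
    by (rule openin_Inter) (use N(2) \<open>openin T ?C\<close> openin_centralizer_of_normal_finite[OF N] in auto)
  show ?thesis
  proof (rule central_procyclicI[OF subA openA g(1)])
    show "A \<subseteq> ?C" by (auto simp: A_def)
    fix x t assume x: "x \<in> carrier G" and t: "t \<in> A"
    obtain n c where nc: "n \<in> N" "c \<in> ?C" "x = c \<otimes> n" using x g(2) by (auto simp: r_coset_def)
    have tn: "t \<in> ?C" "t \<in> carrier G" "t \<otimes> n = n \<otimes> t" using t nc(1) by (auto simp: A_def)
    have tc: "c \<otimes> t = t \<otimes> c" by (rule topgen_commute[OF g(1) nc(2) tn(1)])
    have carr: "c \<in> carrier G" "n \<in> carrier G" using nc CG NG by auto
    have "x \<otimes> t = c \<otimes> (t \<otimes> n)" using nc(3) carr tn by (simp add: m_assoc)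
    also have "\<dots> = t \<otimes> x" using nc(3) carr tn(2) tc by (simp add: m_assoc[symmetric])
    finally show "x \<otimes> t = t \<otimes> x" .
  qed
qed

end

section \<open>Countable procyclic covers\<close>

theorem proposition2p12:
  fixes G :: "('a, 'b) monoid_scheme" and T :: "'a topology"
  assumes "profinite_group G T"
  shows "(\<exists>\<C>. countable \<C> \<and> (\<forall>H\<in>\<C>. procyclic_subgroup H G T) \<and> carrier G = \<Union>\<C>)
     \<longleftrightarrow> finite_by_procyclic G T"
proof
  interpret profinite_group G T by (rule assms)
  assume "\<exists>\<C>. countable \<C> \<and> (\<forall>H\<in>\<C>. procyclic_subgroup H G T) \<and> carrier G = \<Union>\<C>"
  then obtain z where "central_procyclic G T z"
    using central_procyclic_if_countable_cover by blast
  then show "finite_by_procyclic G T" by (rule central_procyclic.finite_by_procyclic)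
next
  interpret profinite_group G T by (rule assms)
  assume "finite_by_procyclic G T"
  then obtain z where "central_procyclic G T z"
    using central_procyclic_if_finite_by_procyclic by blast
  then show "\<exists>\<C>. countable \<C> \<and> (\<forall>H\<in>\<C>. procyclic_subgroup H G T) \<and> carrier G = \<Union>\<C>"
    by (rule central_procyclic.countable_procyclic_cover)
qed

end
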